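(* Let $a>0$, $b>0$, $\sigma>0$, $\frac12<\beta<1$, $r_0>0$, and let $r=\{r_t,t\ge 0\}$ be the unique strong (a.s. strictly positive) solution of $dr_t=(a-br_t)\,dt+\sigma r_t^{\beta}\,dW_t$ with initial value $r_0$, where $W$ is a Wiener process. Let $T>0$. Then for any $t\in[0,T]$, $$\sigma^2=\frac{[r]_t}{\int_0^t r_s^{2\beta}\,ds}=\lim_{h\to0}\frac{[r]_{t+h}-[r]_t}{h\,r_t^{2\beta}}\quad\text{a.s.},$$ where the first equality is asserted for $t>0$ only.
   Context: The initial value $r_0$ is a deterministic constant. The equation has a unique strong solution, a.s. strictly positive for all times. Here $[r]$ is the (continuous) quadratic variation process of $r$, given for each $t$ almost surely by $$[r]_t=\lim_{n\to\infty}\sum_{k=1}^{2^n}\left(r_{\frac{kt}{2^n}}-r_{\frac{(k-1)t}{2^n}}\right)^2.$$ Limits $h\to0$ are over $h\neq0$ with $t+h\ge0$ (one-sided at $t=0$). *)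

theory Defs
  imports "HOL-Probability.Probability"
begin

text \<open>
  Processes are functions \<open>X :: real \<Rightarrow> 'a \<Rightarrow> real\<close> with time as first argument; only the
  values at times \<open>t \<ge> 0\<close> are relevant.
\<close>

definition natural_filtration ::
  "'a measure \<Rightarrow> (real \<Rightarrow> 'a \<Rightarrow> real) \<Rightarrow> real \<Rightarrow> 'a measure" where
  "natural_filtration M X t =
     sigma (space M) {X s -` A \<inter> space M | s A. 0 \<le> s \<and> s \<le> t \<and> A \<in> sets borel}"

text \<open>
  \<open>M\<close> is not assumed to be complete, so the natural filtration is augmented by the measurable
  null sets only. For complete \<open>M\<close> this is the usual augmentation.
\<close>

definition augmented_filtration ::
  "'a measure \<Rightarrow> (real \<Rightarrow> 'a \<Rightarrow> real) \<Rightarrow> real \<Rightarrow> 'a measure" where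
  "augmented_filtration M X t =
     sigma (space M) (sets (natural_filtration M X t) \<union> null_sets M)"

definition continuous_process :: "'a measure \<Rightarrow> (real \<Rightarrow> 'a \<Rightarrow> real) \<Rightarrow> bool" where
  "continuous_process M X \<longleftrightarrow>
     (\<forall>t\<ge>0. X t \<in> borel_measurable M) \<and>
     (AE \<omega> in M. continuous_on {0..} (\<lambda>t. X t \<omega>))"

definition adapted :: "(real \<Rightarrow> 'a measure) \<Rightarrow> (real \<Rightarrow> 'a \<Rightarrow> real) \<Rightarrow> bool" where
  "adapted F X \<longleftrightarrow> (\<forall>t\<ge>0. X t \<in> borel_measurable (F t))"

definition progressively_measurable ::
  "(real \<Rightarrow> 'a measure) \<Rightarrow> (real \<Rightarrow> 'a \<Rightarrow> real) \<Rightarrow> bool" where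
  "progressively_measurable F H \<longleftrightarrow>
     (\<forall>t\<ge>0. (\<lambda>(s, \<omega>). H s \<omega>) \<in> borel_measurable (restrict_space borel {0..t} \<Otimes>\<^sub>M F t))"

definition wiener_process :: "'a measure \<Rightarrow> (real \<Rightarrow> 'a \<Rightarrow> real) \<Rightarrow> bool" where
  "wiener_process M W \<longleftrightarrow>
     continuous_process M W \<and>
     (AE \<omega> in M. W 0 \<omega> = 0) \<and>
     (\<forall>s t. 0 \<le> s \<and> s < t \<longrightarrow>
        distributed M lborel (\<lambda>\<omega>. W t \<omega> - W s \<omega>) (normal_density 0 (sqrt (t - s))) \<and>
        prob_space.indep_set M (sets (natural_filtration M W s))
          {(\<lambda>\<omega>. W t \<omega> - W s \<omega>) -` A \<inter> space M | A. A \<in> sets borel})"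

text \<open>
  A simple integrand is given by times \<open>\<tau> 0 < \<dots> < \<tau> n\<close> and bounded coefficients \<open>\<xi> i\<close>, known at
  time \<open>\<tau> i\<close>; it takes the value \<open>\<xi> i\<close> on the interval from \<open>\<tau> i\<close> (exclusive) to \<open>\<tau> (i + 1)\<close>
  (inclusive).
\<close>

definition simple_integrand ::
  "(real \<Rightarrow> 'a measure) \<Rightarrow> nat \<Rightarrow> (nat \<Rightarrow> real) \<Rightarrow> (nat \<Rightarrow> 'a \<Rightarrow> real) \<Rightarrow> bool" where
  "simple_integrand F n \<tau> \<xi> \<longleftrightarrow>
     0 \<le> \<tau> 0 \<and> (\<forall>i<n. \<tau> i < \<tau> (Suc i)) \<and>
     (\<forall>i<n. \<xi> i \<in> borel_measurable (F (\<tau> i)) \<and>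
            (\<exists>B. \<forall>\<omega>\<in>space (F (\<tau> i)). \<bar>\<xi> i \<omega>\<bar> \<le> B))"

definition simple_process ::
  "nat \<Rightarrow> (nat \<Rightarrow> real) \<Rightarrow> (nat \<Rightarrow> 'a \<Rightarrow> real) \<Rightarrow> real \<Rightarrow> 'a \<Rightarrow> real" where
  "simple_process n \<tau> \<xi> s \<omega> = (\<Sum>i<n. \<xi> i \<omega> * indicator {\<tau> i<..\<tau> (Suc i)} s)"

definition simple_integral ::
  "(real \<Rightarrow> 'a \<Rightarrow> real) \<Rightarrow> nat \<Rightarrow> (nat \<Rightarrow> real) \<Rightarrow> (nat \<Rightarrow> 'a \<Rightarrow> real) \<Rightarrow> real \<Rightarrow> 'a \<Rightarrow> real" where
  "simple_integral W n \<tau> \<xi> t \<omega> =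
     (\<Sum>i<n. \<xi> i \<omega> * (W (min (\<tau> (Suc i)) t) \<omega> - W (min (\<tau> i) t) \<omega>))"

text \<open>
  \<open>has_ito_integral M F W H I\<close>: the continuous process \<open>I\<close> is the Ito integral
  \<open>I t = \<integral>\<^sub>0\<^sup>t H s dW s\<close> of the progressively measurable, pathwise locally square integrable
  process \<open>H\<close>, i.e. there are simple processes converging to \<open>H\<close> in \<open>L\<^sup>2[0,t]\<close> in probability,
  for every \<open>t\<close>, whose integrals up to \<open>t\<close> converge to \<open>I t\<close> in probability. Distances in
  \<open>L\<^sup>2[0,t]\<close> are nonnegative integrals, which are infinite (and not 0) where the integral diverges.
\<close>

definition has_ito_integral ::
  "'a measure \<Rightarrow> (real \<Rightarrow> 'a measure) \<Rightarrow> (real \<Rightarrow> 'a \<Rightarrow> real) \<Rightarrow>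
   (real \<Rightarrow> 'a \<Rightarrow> real) \<Rightarrow> (real \<Rightarrow> 'a \<Rightarrow> real) \<Rightarrow> bool" where
  "has_ito_integral M F W H I \<longleftrightarrow>
     progressively_measurable F H \<and>
     (\<forall>t\<ge>0. AE \<omega> in M. set_integrable lborel {0..t} (\<lambda>s. (H s \<omega>)\<^sup>2)) \<and>
     adapted F I \<and> continuous_process M I \<and>
     (\<exists>n \<tau> \<xi>.
        (\<forall>k. simple_integrand F (n k) (\<tau> k) (\<xi> k)) \<and>
        (\<forall>t\<ge>0. \<forall>\<epsilon>>0.
           (\<lambda>k. measure M {\<omega> \<in> space M.
                  (\<integral>\<^sup>+ s\<in>{0..t}. ennreal ((simple_process (n k) (\<tau> k) (\<xi> k) s \<omega> - H s \<omega>)\<^sup>2) \<partial>lborel)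
                    > ennreal \<epsilon>}) \<longlonglongrightarrow> 0 \<and>
           (\<lambda>k. measure M {\<omega> \<in> space M.
                  \<bar>simple_integral W (n k) (\<tau> k) (\<xi> k) t \<omega> - I t \<omega>\<bar> > \<epsilon>}) \<longlonglongrightarrow> 0))"

text \<open>
  Strong solution of \<open>dX\<^sub>t = \<mu>(X\<^sub>t) dt + \<gamma>(X\<^sub>t) dW\<^sub>t\<close> with deterministic initial value \<open>x0\<close>:
  a continuous process adapted to the augmented filtration of the given Wiener process.
\<close>

definition strong_solution ::
  "'a measure \<Rightarrow> (real \<Rightarrow> 'a \<Rightarrow> real) \<Rightarrow> (real \<Rightarrow> real) \<Rightarrow> (real \<Rightarrow> real) \<Rightarrow> real \<Rightarrow>
   (real \<Rightarrow> 'a \<Rightarrow> real) \<Rightarrow> bool" where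
  "strong_solution M W \<mu> \<gamma> x0 X \<longleftrightarrow>
     adapted (augmented_filtration M W) X \<and> continuous_process M X \<and>
     (\<forall>t\<ge>0. AE \<omega> in M. set_integrable lborel {0..t} (\<lambda>s. \<mu> (X s \<omega>))) \<and>
     (\<exists>I. has_ito_integral M (augmented_filtration M W) W (\<lambda>s \<omega>. \<gamma> (X s \<omega>)) I \<and>
          (AE \<omega> in M. \<forall>t\<ge>0. X t \<omega> = x0 + (LBINT s:{0..t}. \<mu> (X s \<omega>)) + I t \<omega>))"

definition quadratic_variation ::
  "'a measure \<Rightarrow> (real \<Rightarrow> 'a \<Rightarrow> real) \<Rightarrow> (real \<Rightarrow> 'a \<Rightarrow> real) \<Rightarrow> bool" where
  "quadratic_variation M X Q \<longleftrightarrow>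
     continuous_process M Q \<and>
     (\<forall>t\<ge>0. AE \<omega> in M.
        (\<lambda>n::nat. \<Sum>k = 1..(2::nat)^n.
           (X (real k * t / 2^n) \<omega> - X ((real k - 1) * t / 2^n) \<omega>)\<^sup>2) \<longlonglongrightarrow> Q t \<omega>)"

end

theory Submission
  imports Defs
begin

text \<open>
  Since the dyadic sums of \<open>r\<close> converge to \<open>Q t\<close> almost surely, it suffices to identify the limit
  outside events of arbitrarily small probability. For a simple integrand \<open>H\<^sub>k\<close> the dyadic sums of
  its integral \<open>I\<^sub>k\<close> tend to \<open>\<integral>\<^sub>0\<^sup>t H\<^sub>k\<^sup>2 ds\<close> almost surely, by the quadratic variation of the stopped
  Wiener process and polarization. Truncating a simple integrand at the last time before
  \<open>\<integral>H\<^sup>2 ds\<close> exceeds \<open>\<eta>\<close> and applying the Ito isometry bounds the probability that a dyadic sum of its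
  integral exceeds \<open>\<epsilon>\<close> by \<open>P(\<integral>H\<^sup>2 ds > \<eta>) + \<eta>/\<epsilon>\<close>, uniformly in the mesh; applied to \<open>H\<^sub>l - H\<^sub>k\<close> with
  \<open>l \<rightarrow> \<infinity>\<close> this controls the dyadic sums of \<open>I - I\<^sub>k\<close> for the Ito integral \<open>I\<close>, so that
  \<open>Q t = \<integral>\<^sub>0\<^sup>t H\<^sup>2 ds\<close>. The drift is Lipschitz in time and does not contribute. Continuity in \<open>t\<close>
  yields one null set for all times, and the limit is the fundamental theorem of calculus.
\<close>

section \<open>The Wiener process and its augmented filtration\<close>

text \<open>The definition of the Ito integral \<open>I\<close> gives convergence in probability of
  \<open>I\<^sub>l\<close> only at each fixed time, whereas the quadratic variation involves meshes
  tending to 0. For one mesh only finitely many times matter, so \<open>l\<close> may tend to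
  infinity first; what is then required is an estimate that does not depend on the mesh. Each simple
  integrand is bounded, but with no bound common to the sequence, and closeness in L2 holds only in
  probability: this is why truncation has to precede the isometry. It is carried out on a
  deterministic grid, the common refinement of all times in play, so that no stopping times occur.
  The bound is the same for all meshes because the expected sum of squared block increments is a sum
  over the cells of the grid, however these are grouped. The bound concerns each mesh separately and
  not all fine meshes together. Since the dyadic sums are already known to converge, infinitely many
  good meshes suffice, and the event that all but finitely many are bad obeys the same
  bound.\<close>

text \<open>Pythagoras in L2. It serves twice: for the centered squared increments of the Wiener
  process and for the terms of a discrete stochastic integral.\<close>

lemma orthogonal_sum_square:
  fixes Y :: "'i \<Rightarrow> 'a \<Rightarrow> real"
  assumes "finite A"
    and int: "\<And>i j. i \<in> A \<Longrightarrow> j \<in> A \<Longrightarrow> integrable M (\<lambda>\<omega>. Y i \<omega> * Y j \<omega>)"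
    and orth: "\<And>i j. i \<in> A \<Longrightarrow> j \<in> A \<Longrightarrow> i \<noteq> j \<Longrightarrow> (\<integral>\<omega>. Y i \<omega> * Y j \<omega> \<partial>M) = 0"
  shows "integrable M (\<lambda>\<omega>. (\<Sum>i\<in>A. Y i \<omega>)\<^sup>2)"
    and "(\<integral>\<omega>. (\<Sum>i\<in>A. Y i \<omega>)\<^sup>2 \<partial>M) = (\<Sum>i\<in>A. \<integral>\<omega>. (Y i \<omega>)\<^sup>2 \<partial>M)"
proof -
  have sq: "(\<Sum>i\<in>A. Y i \<omega>)\<^sup>2 = (\<Sum>i\<in>A. \<Sum>j\<in>A. Y i \<omega> * Y j \<omega>)" for \<omega>
    by (simp add: power2_eq_square sum_product)
  show "integrable M (\<lambda>\<omega>. (\<Sum>i\<in>A. Y i \<omega>)\<^sup>2)"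
    unfolding sq by (intro Bochner_Integration.integrable_sum int)
  have "(\<integral>\<omega>. (\<Sum>i\<in>A. Y i \<omega>)\<^sup>2 \<partial>M) = (\<Sum>i\<in>A. \<Sum>j\<in>A. \<integral>\<omega>. Y i \<omega> * Y j \<omega> \<partial>M)"
    unfolding sq by (simp add: int Bochner_Integration.integral_sum Bochner_Integration.integrable_sum)
  also have "\<dots> = (\<Sum>i\<in>A. \<Sum>j\<in>A. if j = i then \<integral>\<omega>. (Y i \<omega>)\<^sup>2 \<partial>M else 0)"
    by (intro sum.cong refl) (auto simp: orth power2_eq_square)
  also have "\<dots> = (\<Sum>i\<in>A. \<integral>\<omega>. (Y i \<omega>)\<^sup>2 \<partial>M)"
    using \<open>finite A\<close> by simp
  finally show "(\<integral>\<omega>. (\<Sum>i\<in>A. Y i \<omega>)\<^sup>2 \<partial>M) = (\<Sum>i\<in>A. \<integral>\<omega>. (Y i \<omega>)\<^sup>2 \<partial>M)" .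
qed

locale wiener_space = prob_space M for M :: "'a measure" +
  fixes W :: "real \<Rightarrow> 'a \<Rightarrow> real"
  assumes wiener: "wiener_process M W"
begin

abbreviation F :: "real \<Rightarrow> 'a measure" where
  "F \<equiv> augmented_filtration M W"

lemma W_measurable [measurable]: "0 \<le> t \<Longrightarrow> W t \<in> borel_measurable M"
  using wiener by (simp add: wiener_process_def continuous_process_def)

lemma natural_generators_subset:
  "{W s -` A \<inter> space M | s A. 0 \<le> s \<and> s \<le> t \<and> A \<in> sets borel} \<subseteq> events"
  using W_measurable by (auto intro: measurable_sets)

lemma sets_natural:
  "sets (natural_filtration M W t) =
     sigma_sets (space M) {W s -` A \<inter> space M | s A. 0 \<le> s \<and> s \<le> t \<and> A \<in> sets borel}"
  unfolding natural_filtration_def by (rule sets_measure_of) auto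

lemma sets_natural_subset: "sets (natural_filtration M W t) \<subseteq> events"
  unfolding sets_natural using natural_generators_subset by (rule sets.sigma_sets_subset)

lemma space_F [simp]: "space (F t) = space M"
  by (simp add: augmented_filtration_def space_measure_of_conv)

lemma F_generators_subset: "sets (natural_filtration M W t) \<union> null_sets M \<subseteq> events"
  using sets_natural_subset by auto

lemma sets_F:
  "sets (F t) = sigma_sets (space M) (sets (natural_filtration M W t) \<union> null_sets M)"
  unfolding augmented_filtration_def
  using F_generators_subset sets.space_closed by (intro sets_measure_of) blast

lemma sets_F_subset: "sets (F t) \<subseteq> events"
  unfolding sets_F using F_generators_subset by (rule sets.sigma_sets_subset)

lemma sets_F_mono: "s \<le> t \<Longrightarrow> sets (F s) \<subseteq> sets (F t)"
  unfolding sets_F sets_natural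
  by (intro sigma_sets_mono'' Un_mono subset_refl sigma_sets_mono')
     (auto intro!: sigma_sets_mono' intro: order_trans)

lemma F_measurable_mono: "s \<le> t \<Longrightarrow> f \<in> borel_measurable (F s) \<Longrightarrow> f \<in> borel_measurable (F t)"
  using sets_F_mono[of s t] by (auto simp: measurable_def)

lemma F_measurable_M: "f \<in> borel_measurable (F s) \<Longrightarrow> f \<in> borel_measurable M"
  using sets_F_subset[of s] by (auto simp: measurable_def)

lemma W_measurable_F: "0 \<le> s \<Longrightarrow> s \<le> t \<Longrightarrow> W s \<in> borel_measurable (F t)"
proof (rule measurableI)
  fix A :: "real set" assume "0 \<le> s" "s \<le> t" "A \<in> sets borel"
  then have "W s -` A \<inter> space M \<in> sets (natural_filtration M W t)"
    unfolding sets_natural by (intro sigma_sets.Basic) auto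
  then show "W s -` A \<inter> space (F t) \<in> sets (F t)"
    unfolding sets_F by (auto intro: sigma_sets.Basic)
qed simp

lemma indep_var_increment:
  assumes "0 \<le> s" "s < t" and Z: "Z \<in> borel_measurable (F s)"
  shows "indep_var borel Z borel (\<lambda>\<omega>. W t \<omega> - W s \<omega>)"
proof -
  let ?D = "\<lambda>\<omega>. W t \<omega> - W s \<omega>"
  let ?N = "sets (natural_filtration M W s)" and ?G = "{?D -` A \<inter> space M | A. A \<in> sets borel}"
  have [measurable]: "?D \<in> borel_measurable M"
    using assms by (intro borel_measurable_diff W_measurable) auto
  have indep: "indep_set ?N ?G"
    using wiener assms by (simp add: wiener_process_def)
  have "indep_set (?N \<union> null_sets M) ?G"
  proof (rule indep_setI)
    fix A B assume A: "A \<in> ?N \<union> null_sets M" and B: "B \<in> ?G"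
    have ev: "B \<in> events" using B by (auto intro: measurable_sets)
    show "prob (A \<inter> B) = prob A * prob B"
    proof (cases "A \<in> null_sets M")
      case True
      then have "A \<inter> B \<in> null_sets M" using ev by (rule null_set_Int2)
      then show ?thesis using True by (simp add: null_sets_def measure_def)
    next
      case False
      then show ?thesis using A B indep_setD[OF indep] by blast
    qed
  qed (use F_generators_subset in \<open>auto intro: measurable_sets\<close>)
  \<comment> \<open>An event intersected with a null set is a null set, so independence need only be checked on
    this generator of \<open>F s\<close>.\<close>
  moreover have "Int_stable (?N \<union> null_sets M)"
    using sets_natural_subset
    by (auto simp: Int_stable_def intro: null_set_Int1 null_set_Int2)
  moreover have "Int_stable ?G"
  proof (rule Int_stableI)
    fix a b assume "a \<in> ?G" "b \<in> ?G"
    then obtain A B where "A \<in> sets borel" "a = ?D -` A \<inter> space M" "B \<in> sets borel" "b = ?D -` B \<inter> space M"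
      by auto
    then have "A \<inter> B \<in> sets borel" "a \<inter> b = ?D -` (A \<inter> B) \<inter> space M" by auto
    then show "a \<inter> b \<in> ?G" by blast
  qed
  ultimately have "indep_set (sets (F s)) (sigma_sets (space M) ?G)"
    unfolding sets_F by (rule indep_set_sigma_sets)
  moreover have "sigma_sets (space M) {Z -` A \<inter> space M | A. A \<in> sets borel} \<subseteq> sets (F s)"
  proof -
    have "{Z -` A \<inter> space M | A. A \<in> sets borel} \<subseteq> sets (F s)"
      using measurable_sets[OF Z] by auto
    from sets.sigma_sets_subset[OF this] show ?thesis by simp
  qed
  ultimately have "indep_set (sigma_sets (space M) {Z -` A \<inter> space M | A. A \<in> sets borel}) (sigma_sets (space M) ?G)"
    unfolding indep_sets2_eq by blast
  then show ?thesis
    unfolding indep_var_eq using F_measurable_M[OF Z] by simp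
qed

lemma increment_moments:
  assumes "0 \<le> s" "s \<le> t"
  defines "D \<equiv> \<lambda>\<omega>. W t \<omega> - W s \<omega>"
  shows "integrable M (\<lambda>\<omega>. D \<omega> ^ k)"
    and "expectation D = 0" and "expectation (\<lambda>\<omega>. (D \<omega>)\<^sup>2) = t - s"
    and "expectation (\<lambda>\<omega>. ((D \<omega>)\<^sup>2 - (t - s))\<^sup>2) = 2 * (t - s)\<^sup>2"
proof -
  have "integrable M (\<lambda>\<omega>. D \<omega> ^ k) \<and> expectation D = 0 \<and> expectation (\<lambda>\<omega>. (D \<omega>)\<^sup>2) = t - s \<and>
     expectation (\<lambda>\<omega>. ((D \<omega>)\<^sup>2 - (t - s))\<^sup>2) = 2 * (t - s)\<^sup>2"
  \<comment> \<open>The Wiener property is stated for \<open>s < t\<close>. The degenerate case has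
    to be included because grids are only weakly increasing once times are stopped.\<close>
  proof (cases "s = t")
    case True
    then have "D = (\<lambda>_. 0)" by (auto simp: D_def)
    then show ?thesis using True by simp
  next
    case False
    with assms have "s < t" by simp
    let ?\<sigma> = "sqrt (t - s)"
    have \<sigma>: "?\<sigma> > 0" "?\<sigma>\<^sup>2 = t - s" using \<open>s < t\<close> by auto
    have D: "distributed M lborel D (normal_density 0 ?\<sigma>)"
      using wiener assms(1) \<open>s < t\<close> by (simp add: wiener_process_def D_def)
    have int: "integrable M (\<lambda>\<omega>. D \<omega> ^ k)" for k
      using integrable_normal_moment[OF \<sigma>(1), of 0 k] distributed_integrable[OF D, of "\<lambda>x. x ^ k"] \<sigma>
      by simp
    have mom: "expectation (\<lambda>\<omega>. D \<omega> ^ k) = (\<integral>x. normal_density 0 ?\<sigma> x * (x - 0) ^ k \<partial>lborel)" for k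
      using distributed_integral[OF D, of "\<lambda>x. x ^ k"] \<sigma> by simp
    have "expectation D = 0"
      using mom[of 1] integral_normal_moment_odd[OF \<sigma>(1), of 0 0] by simp
    moreover have 2: "expectation (\<lambda>\<omega>. (D \<omega>)\<^sup>2) = t - s"
      using mom[of 2] integral_normal_moment_even[OF \<sigma>(1), of 0 1] \<sigma>(2) by (simp add: numeral_2_eq_2)
    moreover have "expectation (\<lambda>\<omega>. (D \<omega>)^4) = 3 * (t - s)\<^sup>2"
    proof -
      have "expectation (\<lambda>\<omega>. (D \<omega>)^4) = fact (2 * 2) / ((2 / ?\<sigma>\<^sup>2)^2 * fact 2)"
        using mom[of 4] integral_normal_moment_even[OF \<sigma>(1), of 0 2] by simp
      also have "\<dots> = 3 * (t - s)\<^sup>2"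
        unfolding \<sigma>(2) using \<open>s < t\<close> by (simp add: fact_numeral field_simps)
      finally show ?thesis .
    qed
    moreover from this have "expectation (\<lambda>\<omega>. ((D \<omega>)\<^sup>2 - (t - s))\<^sup>2) = 2 * (t - s)\<^sup>2"
    proof -
      assume 4: "expectation (\<lambda>\<omega>. (D \<omega>)^4) = 3 * (t - s)\<^sup>2"
      have "expectation (\<lambda>\<omega>. ((D \<omega>)\<^sup>2 - (t - s))\<^sup>2) =
          expectation (\<lambda>\<omega>. (D \<omega>)^4 - 2 * (t - s) * (D \<omega>)\<^sup>2 + (t - s)\<^sup>2)"
        by (intro Bochner_Integration.integral_cong refl)
           (simp add: power2_eq_square power4_eq_xxxx algebra_simps)
      also have "\<dots> = 3 * (t - s)\<^sup>2 - 2 * (t - s) * (t - s) + (t - s)\<^sup>2"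
        using int[of 4] int[of 2] 2 4
        by (simp add: prob_space del: right_diff_distrib_numeral left_diff_distrib_numeral)
      finally show ?thesis by (simp add: power2_eq_square)
    qed
    ultimately show ?thesis
      using int by blast
  qed
  then show "integrable M (\<lambda>\<omega>. D \<omega> ^ k)" "expectation D = 0" "expectation (\<lambda>\<omega>. (D \<omega>)\<^sup>2) = t - s"
    "expectation (\<lambda>\<omega>. ((D \<omega>)\<^sup>2 - (t - s))\<^sup>2) = 2 * (t - s)\<^sup>2" by auto
qed

text \<open>This factorization stands in for conditional expectations. The function
  \<open>\<phi>\<close> covers the three cases that occur: the increment itself, its square, and its
  square minus the variance.\<close>

lemma expectation_mult_increment:
  fixes \<phi> :: "real \<Rightarrow> real"
  assumes "0 \<le> s" "s \<le> t" and Z: "Z \<in> borel_measurable (F s)" "integrable M Z"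
    and \<phi>: "\<phi> \<in> borel_measurable borel" "integrable M (\<lambda>\<omega>. \<phi> (W t \<omega> - W s \<omega>))"
  shows "integrable M (\<lambda>\<omega>. Z \<omega> * \<phi> (W t \<omega> - W s \<omega>))"
    and "expectation (\<lambda>\<omega>. Z \<omega> * \<phi> (W t \<omega> - W s \<omega>)) =
           expectation Z * expectation (\<lambda>\<omega>. \<phi> (W t \<omega> - W s \<omega>))"
proof -
  have *: "integrable M (\<lambda>\<omega>. Z \<omega> * \<phi> (W t \<omega> - W s \<omega>)) \<and>
    expectation (\<lambda>\<omega>. Z \<omega> * \<phi> (W t \<omega> - W s \<omega>)) =
           expectation Z * expectation (\<lambda>\<omega>. \<phi> (W t \<omega> - W s \<omega>))"
  proof (cases "s = t")
    case True
    then show ?thesis using Z by (simp add: prob_space)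
  next
    case False
    then have "indep_var borel Z borel (\<lambda>\<omega>. W t \<omega> - W s \<omega>)"
      using assms by (intro indep_var_increment) auto
    from indep_var_compose[OF this measurable_ident \<phi>(1)]
    have i: "indep_var borel Z borel (\<lambda>\<omega>. \<phi> (W t \<omega> - W s \<omega>))"
      by (simp add: comp_def)
    show ?thesis
      using indep_var_lebesgue_integral[OF i Z(2) \<phi>(2)] indep_var_integrable[OF i Z(2) \<phi>(2)] by simp
  qed
  show "integrable M (\<lambda>\<omega>. Z \<omega> * \<phi> (W t \<omega> - W s \<omega>))" using * by simp
  show "expectation (\<lambda>\<omega>. Z \<omega> * \<phi> (W t \<omega> - W s \<omega>)) =
           expectation Z * expectation (\<lambda>\<omega>. \<phi> (W t \<omega> - W s \<omega>))" using * by simp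
qed

end

section \<open>Dyadic sums of squares\<close>

text \<open>The sum of all \<open>(X n \<omega>)\<^sup>2\<close> has finite integral, so it is
  finite almost everywhere and its terms tend to 0. This takes the place of Chebyshev and
  Borel-Cantelli.\<close>

lemma sq_L2_summable_tendsto_0:
  fixes X :: "nat \<Rightarrow> 'a \<Rightarrow> real"
  assumes int: "\<And>n. integrable M (\<lambda>\<omega>. (X n \<omega>)\<^sup>2)"
    and sum: "summable (\<lambda>n. \<integral>\<omega>. (X n \<omega>)\<^sup>2 \<partial>M)"
  shows "AE \<omega> in M. (\<lambda>n. X n \<omega>) \<longlonglongrightarrow> 0"
proof -
  have [measurable]: "(\<lambda>\<omega>. (X n \<omega>)\<^sup>2) \<in> borel_measurable M" for n
    using int by auto
  have "(\<integral>\<^sup>+\<omega>. (\<Sum>n. ennreal ((X n \<omega>)\<^sup>2)) \<partial>M) = (\<Sum>n. \<integral>\<^sup>+\<omega>. ennreal ((X n \<omega>)\<^sup>2) \<partial>M)"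
    by (intro nn_integral_suminf) measurable
  also have "\<dots> = (\<Sum>n. ennreal (\<integral>\<omega>. (X n \<omega>)\<^sup>2 \<partial>M))"
    by (intro suminf_cong nn_integral_eq_integral int) auto
  also have "\<dots> = ennreal (\<Sum>n. \<integral>\<omega>. (X n \<omega>)\<^sup>2 \<partial>M)"
    by (intro suminf_ennreal2 sum) auto
  finally have "(\<integral>\<^sup>+\<omega>. (\<Sum>n. ennreal ((X n \<omega>)\<^sup>2)) \<partial>M) \<noteq> \<infinity>" by simp
  then have "AE \<omega> in M. (\<Sum>n. ennreal ((X n \<omega>)\<^sup>2)) \<noteq> \<infinity>"
    by (intro nn_integral_noteq_infinite) measurable
  then show ?thesis
  proof eventually_elim
    case (elim \<omega>)
    then have "summable (\<lambda>n. (X n \<omega>)\<^sup>2)"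
      by (intro summable_suminf_not_top) auto
    then have "(\<lambda>n. (X n \<omega>)\<^sup>2) \<longlonglongrightarrow> 0" by (rule summable_LIMSEQ_zero)
    then show ?case by (rule power_tendsto_0_iff[THEN iffD1, rotated]) simp
  qed
qed

section \<open>Dyadic increments and their mixed sums\<close>

definition dyadic_incr :: "(real \<Rightarrow> real) \<Rightarrow> real \<Rightarrow> nat \<Rightarrow> nat \<Rightarrow> real" where
  "dyadic_incr f t n k = f (real (Suc k) * t / 2 ^ n) - f (real k * t / 2 ^ n)"

text \<open>Mixed sums are needed because the square sum of a simple integral expands into products
  of increments of differently stopped Wiener processes.\<close>

definition dyadic_covar :: "(real \<Rightarrow> real) \<Rightarrow> (real \<Rightarrow> real) \<Rightarrow> real \<Rightarrow> nat \<Rightarrow> real" where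
  "dyadic_covar f g t n = (\<Sum>k<2 ^ n. dyadic_incr f t n k * dyadic_incr g t n k)"

abbreviation dyadic_sq_sum :: "(real \<Rightarrow> real) \<Rightarrow> real \<Rightarrow> nat \<Rightarrow> real" where
  "dyadic_sq_sum f \<equiv> dyadic_covar f f"

lemma dyadic_sq_sum_eq: "dyadic_sq_sum f t n = (\<Sum>k<2 ^ n. (dyadic_incr f t n k)\<^sup>2)"
  by (simp add: dyadic_covar_def power2_eq_square)

lemma dyadic_sq_sum_nonneg: "0 \<le> dyadic_sq_sum f t n"
  by (simp add: dyadic_sq_sum_eq sum_nonneg)

text \<open>The sum in the definition of quadratic variation is indexed by right endpoints, the one
  used here by left endpoints.\<close>

lemma dyadic_sq_sum_from_1:
  "(\<Sum>k = 1..(2::nat) ^ n. (f (real k * t / 2 ^ n) - f ((real k - 1) * t / 2 ^ n))\<^sup>2) = dyadic_sq_sum f t n"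
proof -
  have "(\<Sum>k = 1..(2::nat) ^ n. (f (real k * t / 2 ^ n) - f ((real k - 1) * t / 2 ^ n))\<^sup>2) =
    (\<Sum>k<2 ^ n. (f (real (Suc k) * t / 2 ^ n) - f ((real (Suc k) - 1) * t / 2 ^ n))\<^sup>2)"
    by (rule sum.reindex_bij_witness[of _ Suc "\<lambda>k. k - 1"]) auto
  then show ?thesis by (simp add: dyadic_sq_sum_eq dyadic_incr_def)
qed

lemma dyadic_covar_commute: "dyadic_covar f g t n = dyadic_covar g f t n"
  by (simp add: dyadic_covar_def mult.commute)

lemma dyadic_covar_polarization:
  "dyadic_covar f g t n =
     (dyadic_sq_sum f t n + dyadic_sq_sum g t n - dyadic_sq_sum (\<lambda>x. g x - f x) t n) / 2"
proof -
  have "2 * dyadic_covar f g t n =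
    dyadic_sq_sum f t n + dyadic_sq_sum g t n - dyadic_sq_sum (\<lambda>x. g x - f x) t n"
    unfolding dyadic_covar_def sum_distrib_left sum.distrib[symmetric] sum_subtractf[symmetric]
    by (intro sum.cong refl) (simp add: dyadic_incr_def algebra_simps)
  then show ?thesis by simp
qed

text \<open>There are \<open>2 ^ n\<close> increments, each at most \<open>L * t / 2 ^ n\<close>.
  Used both for the drift and for the deterministic clocks along which the Wiener process is run,
  where the square sum of the clock is half of a mean square error.\<close>

lemma dyadic_sq_sum_lipschitz:
  assumes "0 \<le> t" and "\<And>x y. 0 \<le> x \<Longrightarrow> x \<le> y \<Longrightarrow> y \<le> t \<Longrightarrow> \<bar>f y - f x\<bar> \<le> L * (y - x)"
  shows "dyadic_sq_sum f t n \<le> (L * t)\<^sup>2 / 2 ^ n"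
proof -
  have "(dyadic_incr f t n k)\<^sup>2 \<le> (L * t / 2 ^ n)\<^sup>2" if "k < 2 ^ n" for k
  proof -
    have "real (Suc k) \<le> real (2 ^ n)" using that unfolding of_nat_le_iff by (simp add: Suc_le_eq)
    then have "real (Suc k) * t \<le> 2 ^ n * t" using \<open>0 \<le> t\<close> by (intro mult_right_mono) auto
    then have "\<bar>dyadic_incr f t n k\<bar> \<le> L * (real (Suc k) * t / 2 ^ n - real k * t / 2 ^ n)"
      unfolding dyadic_incr_def using \<open>0 \<le> t\<close> mult_right_mono[of "real k" "real (Suc k)" t]
      by (intro assms(2)) (auto simp: field_simps)
    also have "\<dots> = L * t / 2 ^ n" by (simp add: field_simps)
    finally show ?thesis by (metis abs_ge_zero power2_abs power_mono)
  qed
  then have "dyadic_sq_sum f t n \<le> (\<Sum>k<(2::nat) ^ n. (L * t / 2 ^ n)\<^sup>2)"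
    unfolding dyadic_sq_sum_eq by (intro sum_mono) auto
  also have "\<dots> = (L * t)\<^sup>2 / 2 ^ n" by (simp add: power2_eq_square field_simps)
  finally show ?thesis .
qed

lemma sum_swap3: "(\<Sum>k\<in>A. \<Sum>i\<in>B. \<Sum>j\<in>C. f k i j) = (\<Sum>i\<in>B. \<Sum>j\<in>C. \<Sum>k\<in>A. f k i j)"
  by (rule trans[OF sum.swap]) (intro sum.cong refl sum.swap)

lemma simple_integrand_times:
  assumes "simple_integrand F n \<tau> \<xi>"
  shows "i < n \<Longrightarrow> \<tau> i < \<tau> (Suc i)" "i \<le> j \<Longrightarrow> j \<le> n \<Longrightarrow> \<tau> i \<le> \<tau> j" "i \<le> n \<Longrightarrow> 0 \<le> \<tau> i"
proof -
  show incr: "\<tau> i < \<tau> (Suc i)" if "i < n" for i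
    using assms that by (simp add: simple_integrand_def)
  show mono: "\<tau> i \<le> \<tau> j" if "i \<le> j" "j \<le> n" for i j
    using that
  proof (induction j rule: dec_induct)
    case (step j) then show ?case using incr[of j] by simp
  qed simp
  show "0 \<le> \<tau> i" if "i \<le> n"
    using mono[of 0 i] that assms by (simp add: simple_integrand_def)
qed

section \<open>Quadratic variation of the Wiener process and of simple integrals\<close>

context wiener_space
begin

lemma increment_sq_centered:
  assumes "0 \<le> s" "s \<le> t"
  shows "integrable M (\<lambda>\<omega>. (W t \<omega> - W s \<omega>)\<^sup>2 - c)"
    and "integrable M (\<lambda>\<omega>. ((W t \<omega> - W s \<omega>)\<^sup>2 - c)\<^sup>2)"
proof -
  note [simp] = increment_moments(1)[OF assms]
  show "integrable M (\<lambda>\<omega>. (W t \<omega> - W s \<omega>)\<^sup>2 - c)" by simp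
  have "((W t \<omega> - W s \<omega>)\<^sup>2 - c)\<^sup>2 = (W t \<omega> - W s \<omega>)^4 - 2 * c * (W t \<omega> - W s \<omega>)\<^sup>2 + c\<^sup>2" for \<omega>
    by (simp add: power2_eq_square power4_eq_xxxx algebra_simps)
  then show "integrable M (\<lambda>\<omega>. ((W t \<omega> - W s \<omega>)\<^sup>2 - c)\<^sup>2)" by simp
qed

text \<open>A squared increment minus its variance is centered and independent of the earlier ones;
  the deviations are therefore orthogonal and their mean squares add up.\<close>

lemma wiener_square_sum_L2:
  fixes q :: "nat \<Rightarrow> real"
  assumes q: "mono_on {..N} q" "0 \<le> q 0"
  defines "R \<equiv> \<lambda>\<omega>. (\<Sum>i<N. (W (q (Suc i)) \<omega> - W (q i) \<omega>)\<^sup>2) - (q N - q 0)"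
  shows "integrable M (\<lambda>\<omega>. (R \<omega>)\<^sup>2)"
    and "expectation (\<lambda>\<omega>. (R \<omega>)\<^sup>2) = (\<Sum>i<N. 2 * (q (Suc i) - q i)\<^sup>2)"
proof -
  define Y where "Y = (\<lambda>i \<omega>. (W (q (Suc i)) \<omega> - W (q i) \<omega>)\<^sup>2 - (q (Suc i) - q i))"
  have q_le: "q i \<le> q j" if "i \<le> j" "j \<le> N" for i j using q(1) that by (auto simp: mono_on_def)
  have q_nn: "0 \<le> q i" if "i \<le> N" for i using q_le[of 0 i] that q(2) by simp
  have R: "R = (\<lambda>\<omega>. \<Sum>i<N. Y i \<omega>)"
    unfolding R_def Y_def sum_subtractf[of _ "\<lambda>i. q (Suc i) - q i"] sum_lessThan_telescope ..
  have *: "integrable M (\<lambda>\<omega>. Y i \<omega> * Y j \<omega>) \<and> expectation (\<lambda>\<omega>. Y i \<omega> * Y j \<omega>) = 0"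
    if "i < j" "j < N" for i j
  proof -
    have "Y i \<in> borel_measurable (F (q j))"
      unfolding Y_def using that q_le q_nn
      by (intro borel_measurable_diff borel_measurable_power borel_measurable_const W_measurable_F) auto
    moreover have "integrable M (Y i)"
      unfolding Y_def using that q_le q_nn by (intro increment_sq_centered) auto
    moreover have "expectation (\<lambda>\<omega>. (W (q (Suc j)) \<omega> - W (q j) \<omega>)\<^sup>2 - (q (Suc j) - q j)) = 0"
      using increment_moments[of "q j" "q (Suc j)"] that q_le[of j "Suc j"] q_nn[of j]
      by (simp add: prob_space)
    ultimately show ?thesis
      using expectation_mult_increment[of "q j" "q (Suc j)" "Y i" "\<lambda>x. x\<^sup>2 - (q (Suc j) - q j)"]
        that q_le[of j "Suc j"] q_nn[of j] increment_sq_centered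
      by (simp add: Y_def)
  qed
  have int: "integrable M (\<lambda>\<omega>. Y i \<omega> * Y j \<omega>)" if "i < N" "j < N" for i j
  proof (cases i j rule: linorder_cases)
    case less then show ?thesis using * that by simp
  next
    case greater then show ?thesis using *[of j i] that by (simp add: mult.commute)
  next
    case equal then show ?thesis
      using that q_le q_nn increment_sq_centered(2)[of "q i" "q (Suc i)"]
      by (simp add: Y_def power2_eq_square)
  qed
  have orth: "expectation (\<lambda>\<omega>. Y i \<omega> * Y j \<omega>) = 0" if "i < N" "j < N" "i \<noteq> j" for i j
    using *[of i j] *[of j i] that by (cases "i < j") (auto simp: mult.commute)
  show "integrable M (\<lambda>\<omega>. (R \<omega>)\<^sup>2)"
    unfolding R by (rule orthogonal_sum_square) (auto intro: int orth)
  have "expectation (\<lambda>\<omega>. (R \<omega>)\<^sup>2) = (\<Sum>i<N. expectation (\<lambda>\<omega>. (Y i \<omega>)\<^sup>2))"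
    unfolding R by (rule orthogonal_sum_square) (auto intro: int orth)
  also have "\<dots> = (\<Sum>i<N. 2 * (q (Suc i) - q i)\<^sup>2)"
    unfolding Y_def using q_le q_nn by (intro sum.cong refl increment_moments(4)) auto
  finally show "expectation (\<lambda>\<omega>. (R \<omega>)\<^sup>2) = (\<Sum>i<N. 2 * (q (Suc i) - q i)\<^sup>2)" .
qed

text \<open>The function \<open>c\<close> is a deterministic clock that never runs faster than real
  time; stopped Wiener processes are of this form. The mean square error at level \<open>n\<close>
  is at most \<open>2 * t\<^sup>2 / 2 ^ n\<close>, and its summability is what turns L2 convergence
  into almost sure convergence along dyadic meshes.\<close>

lemma wiener_dyadic_sq_sum:
  fixes c :: "real \<Rightarrow> real"
  assumes "0 \<le> t" "mono c" "0 \<le> c 0" and lip: "\<And>x y. x \<le> y \<Longrightarrow> c y - c x \<le> y - x"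
  shows "AE \<omega> in M. (\<lambda>n. dyadic_sq_sum (\<lambda>x. W (c x) \<omega>) t n) \<longlonglongrightarrow> c t - c 0"
proof -
  define q where "q = (\<lambda>n k. c (real k * t / 2 ^ n))"
  define R where "R = (\<lambda>n \<omega>. dyadic_sq_sum (\<lambda>x. W (c x) \<omega>) t n - (c t - c 0))"
  have R: "R n \<omega> = (\<Sum>i<2 ^ n. (W (q n (Suc i)) \<omega> - W (q n i) \<omega>)\<^sup>2) - (q n (2 ^ n) - q n 0)" for n \<omega>
    by (simp add: R_def q_def dyadic_sq_sum_eq dyadic_incr_def)
  have m: "mono_on {..2 ^ n} (q n)" for n
    unfolding q_def using \<open>0 \<le> t\<close>
    by (intro mono_onI monoD[OF \<open>mono c\<close>] divide_right_mono mult_right_mono) auto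
  have q0: "0 \<le> q n 0" for n using assms by (simp add: q_def)
  have "summable (\<lambda>n. expectation (\<lambda>\<omega>. (R n \<omega>)\<^sup>2))"
  proof (rule summable_comparison_test)
    have "norm (expectation (\<lambda>\<omega>. (R n \<omega>)\<^sup>2)) \<le> 2 * t\<^sup>2 * (1 / 2) ^ n" for n
    proof -
      have "norm (expectation (\<lambda>\<omega>. (R n \<omega>)\<^sup>2)) = (\<Sum>i<2 ^ n. 2 * (q n (Suc i) - q n i)\<^sup>2)"
        unfolding R wiener_square_sum_L2(2)[OF m q0] by (simp add: sum_nonneg)
      also have "\<dots> = 2 * dyadic_sq_sum c t n"
        by (simp add: dyadic_sq_sum_eq dyadic_incr_def q_def sum_distrib_left)
      also have "\<dots> \<le> 2 * ((1 * t)\<^sup>2 / 2 ^ n)"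
        using lip monoD[OF \<open>mono c\<close>] \<open>0 \<le> t\<close>
        by (intro mult_left_mono dyadic_sq_sum_lipschitz) auto
      finally show ?thesis by (simp add: power_one_over)
    qed
    then show "\<exists>N. \<forall>n\<ge>N. norm (expectation (\<lambda>\<omega>. (R n \<omega>)\<^sup>2)) \<le> 2 * t\<^sup>2 * (1 / 2) ^ n" by blast
    show "summable (\<lambda>n. 2 * t\<^sup>2 * (1 / 2) ^ n :: real)"
      by (intro summable_mult summable_geometric) simp
  qed
  moreover have "integrable M (\<lambda>\<omega>. (R n \<omega>)\<^sup>2)" for n
    unfolding R by (rule wiener_square_sum_L2(1)[OF m q0])
  ultimately have "AE \<omega> in M. (\<lambda>n. R n \<omega>) \<longlonglongrightarrow> 0"
    by (intro sq_L2_summable_tendsto_0)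
  then show ?thesis
  proof eventually_elim
    case (elim \<omega>)
    then show ?case unfolding R_def by (simp add: LIM_zero_iff)
  qed
qed

text \<open>By polarization three square sums suffice. For \<open>s \<le> u\<close> the difference
  of the two stopped processes is, up to the constant \<open>W s\<close>, the Wiener process run
  along the clock \<open>max s (min u x)\<close>, so all three are covered by
  \<open>wiener_dyadic_sq_sum\<close>.\<close>

lemma stopped_wiener_dyadic_covar:
  assumes "0 \<le> t" "0 \<le> s" "0 \<le> u"
  shows "AE \<omega> in M. (\<lambda>n. dyadic_covar (\<lambda>x. W (min s x) \<omega>) (\<lambda>x. W (min u x) \<omega>) t n)
           \<longlonglongrightarrow> min (min s u) t"
  using assms(2,3)
proof (induction s u rule: linorder_wlog)
  case (sym s u)
  then show ?case by (simp add: dyadic_covar_commute min.commute)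
next
  case (le s u)
  have "AE \<omega> in M. (\<lambda>n. dyadic_sq_sum (\<lambda>x. W (min s x) \<omega>) t n) \<longlonglongrightarrow> min s t - min s 0"
    using le assms(1) by (intro wiener_dyadic_sq_sum) (auto simp: mono_def min_def)
  moreover have "AE \<omega> in M. (\<lambda>n. dyadic_sq_sum (\<lambda>x. W (min u x) \<omega>) t n) \<longlonglongrightarrow> min u t - min u 0"
    using le assms(1) by (intro wiener_dyadic_sq_sum) (auto simp: mono_def min_def)
  moreover have "AE \<omega> in M. (\<lambda>n. dyadic_sq_sum (\<lambda>x. W (max s (min u x)) \<omega>) t n)
      \<longlonglongrightarrow> max s (min u t) - max s (min u 0)"
    using le assms(1) by (intro wiener_dyadic_sq_sum) (auto simp: mono_def min_def max_def)
  ultimately show ?case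
  proof eventually_elim
    case (elim \<omega>)
    have "W (min u x) \<omega> - W (min s x) \<omega> = W (max s (min u x)) \<omega> - W s \<omega>" for x
      using le by (auto simp: min_def max_def)
    then have eq: "dyadic_sq_sum (\<lambda>x. W (min u x) \<omega> - W (min s x) \<omega>) t n =
        dyadic_sq_sum (\<lambda>x. W (max s (min u x)) \<omega>) t n" for n
      by (simp add: dyadic_sq_sum_eq dyadic_incr_def)
    have cov: "dyadic_covar (\<lambda>x. W (min s x) \<omega>) (\<lambda>x. W (min u x) \<omega>) t n =
       (dyadic_sq_sum (\<lambda>x. W (min s x) \<omega>) t n + dyadic_sq_sum (\<lambda>x. W (min u x) \<omega>) t n -
        dyadic_sq_sum (\<lambda>x. W (max s (min u x)) \<omega>) t n) / 2" for n
      using dyadic_covar_polarization eq by simp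
    have "(\<lambda>n. dyadic_covar (\<lambda>x. W (min s x) \<omega>) (\<lambda>x. W (min u x) \<omega>) t n) \<longlonglongrightarrow>
      ((min s t - min s 0) + (min u t - min u 0) - (max s (min u t) - max s (min u 0))) / 2"
      unfolding cov by (intro tendsto_divide tendsto_diff tendsto_add tendsto_const elim) simp
    also have "((min s t - min s 0) + (min u t - min u 0) - (max s (min u t) - max s (min u 0))) / 2
        = min (min s u) t"
      using le assms(1) by (cases "t \<le> s") (simp_all add: min_absorb1 min_absorb2 max_absorb1 max_absorb2)
    finally show ?case .
  qed
qed

text \<open>For fixed \<open>\<omega>\<close> the coefficients are constants, so the square sum is a
  fixed bilinear combination of the mixed sums of stopped Wiener processes and converges with
  them.\<close>

lemma simple_integral_dyadic_sq_sum:
  assumes "simple_integrand F n \<tau> \<xi>" "0 \<le> t"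
  shows "AE \<omega> in M. (\<lambda>m. dyadic_sq_sum (\<lambda>x. simple_integral W n \<tau> \<xi> x \<omega>) t m)
     \<longlonglongrightarrow> (\<Sum>i<n. (\<xi> i \<omega>)\<^sup>2 * (min (\<tau> (Suc i)) t - min (\<tau> i) t))"
proof -
  note \<tau> = simple_integrand_times(2)[OF assms(1)] and \<tau>_nn = simple_integrand_times(3)[OF assms(1)]
  let ?C = "\<lambda>\<omega> i j. dyadic_covar (\<lambda>x. W (min (\<tau> i) x) \<omega>) (\<lambda>x. W (min (\<tau> j) x) \<omega>) t"
  let ?m = "\<lambda>i j. min (min (\<tau> i) (\<tau> j)) t"
  have "AE \<omega> in M. \<forall>i\<le>n. \<forall>j\<le>n. ?C \<omega> i j \<longlonglongrightarrow> ?m i j"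
    using stopped_wiener_dyadic_covar[OF \<open>0 \<le> t\<close> \<tau>_nn \<tau>_nn] by (simp add: AE_all_countable)
  then show ?thesis
  proof eventually_elim
    case (elim \<omega>)
    let ?J = "\<lambda>x. simple_integral W n \<tau> \<xi> x \<omega>"
    have incr: "dyadic_incr ?J t m k =
      (\<Sum>i<n. \<xi> i \<omega> * (dyadic_incr (\<lambda>x. W (min (\<tau> (Suc i)) x) \<omega>) t m k -
         dyadic_incr (\<lambda>x. W (min (\<tau> i) x) \<omega>) t m k))" for m k
      unfolding dyadic_incr_def simple_integral_def sum_subtractf[symmetric]
      by (intro sum.cong refl) (simp add: algebra_simps)
    have "dyadic_sq_sum ?J t m = (\<Sum>i<n. \<Sum>j<n. \<xi> i \<omega> * \<xi> j \<omega> *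
       (?C \<omega> (Suc i) (Suc j) m - ?C \<omega> (Suc i) j m - ?C \<omega> i (Suc j) m + ?C \<omega> i j m))" for m
    proof -
      have "dyadic_sq_sum ?J t m = (\<Sum>k<2 ^ m. \<Sum>i<n. \<Sum>j<n. \<xi> i \<omega> * \<xi> j \<omega> *
        ((dyadic_incr (\<lambda>x. W (min (\<tau> (Suc i)) x) \<omega>) t m k - dyadic_incr (\<lambda>x. W (min (\<tau> i) x) \<omega>) t m k) *
         (dyadic_incr (\<lambda>x. W (min (\<tau> (Suc j)) x) \<omega>) t m k - dyadic_incr (\<lambda>x. W (min (\<tau> j) x) \<omega>) t m k)))"
        unfolding dyadic_covar_def incr sum_product by (simp add: algebra_simps)
      also have "\<dots> = (\<Sum>i<n. \<Sum>j<n. \<Sum>k<2 ^ m. \<xi> i \<omega> * \<xi> j \<omega> *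
        ((dyadic_incr (\<lambda>x. W (min (\<tau> (Suc i)) x) \<omega>) t m k - dyadic_incr (\<lambda>x. W (min (\<tau> i) x) \<omega>) t m k) *
         (dyadic_incr (\<lambda>x. W (min (\<tau> (Suc j)) x) \<omega>) t m k - dyadic_incr (\<lambda>x. W (min (\<tau> j) x) \<omega>) t m k)))"
        by (rule sum_swap3)
      also have "\<dots> = (\<Sum>i<n. \<Sum>j<n. \<xi> i \<omega> * \<xi> j \<omega> *
       (?C \<omega> (Suc i) (Suc j) m - ?C \<omega> (Suc i) j m - ?C \<omega> i (Suc j) m + ?C \<omega> i j m))"
        unfolding sum_distrib_left[symmetric] dyadic_covar_def sum_subtractf[symmetric] sum.distrib[symmetric]
        by (intro sum.cong refl arg_cong2[where f="(*)"]) (simp add: algebra_simps)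
      finally show ?thesis .
    qed
    moreover have "(\<lambda>m. \<Sum>i<n. \<Sum>j<n. \<xi> i \<omega> * \<xi> j \<omega> *
       (?C \<omega> (Suc i) (Suc j) m - ?C \<omega> (Suc i) j m - ?C \<omega> i (Suc j) m + ?C \<omega> i j m))
      \<longlonglongrightarrow> (\<Sum>i<n. \<Sum>j<n. \<xi> i \<omega> * \<xi> j \<omega> * (?m (Suc i) (Suc j) - ?m (Suc i) j - ?m i (Suc j) + ?m i j))"
      by (intro tendsto_intros elim[rule_format]) auto
    \<comment> \<open>The second difference of \<open>?m\<close> is the length of the overlap of the
      \<open>i\<close>-th and \<open>j\<close>-th intervals within \<open>[0,t]\<close>; distinct
      intervals do not overlap.\<close>
    moreover have "(\<Sum>i<n. \<Sum>j<n. \<xi> i \<omega> * \<xi> j \<omega> * (?m (Suc i) (Suc j) - ?m (Suc i) j - ?m i (Suc j) + ?m i j))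
      = (\<Sum>i<n. \<Sum>j<n. if j = i then (\<xi> i \<omega>)\<^sup>2 * (min (\<tau> (Suc i)) t - min (\<tau> i) t) else 0)"
    proof (intro sum.cong refl)
      fix i j assume "i \<in> {..<n}" "j \<in> {..<n}"
      then have ij: "i < n" "j < n" by auto
      consider "i = j" | "Suc i \<le> j" | "Suc j \<le> i" by linarith
      then show "\<xi> i \<omega> * \<xi> j \<omega> * (?m (Suc i) (Suc j) - ?m (Suc i) j - ?m i (Suc j) + ?m i j)
        = (if j = i then (\<xi> i \<omega>)\<^sup>2 * (min (\<tau> (Suc i)) t - min (\<tau> i) t) else 0)"
      proof cases
        case 1
        then show ?thesis using \<tau>[of i "Suc i"] ij by (simp add: power2_eq_square min_absorb1 min_absorb2)
      next
        case 2
        then show ?thesis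
          using \<tau>[of "Suc i" "j"] \<tau>[of i "Suc i"] \<tau>[of j "Suc j"] ij by (simp add: min_absorb1 min_absorb2)
      next
        case 3
        then show ?thesis
          using \<tau>[of "Suc j" "i"] \<tau>[of i "Suc i"] \<tau>[of j "Suc j"] ij by (simp add: min_absorb1 min_absorb2)
      qed
    qed
    ultimately show ?case by simp
  qed
qed

end

section \<open>Small integrands have small dyadic square sums\<close>

text \<open>The partial sums increase, so the terms kept form an initial segment, and the last
  partial sum kept is at most \<open>\<eta>\<close>.\<close>

lemma truncated_sum_le:
  fixes a :: "nat \<Rightarrow> real"
  assumes "\<And>i. 0 \<le> a i" "0 \<le> \<eta>"
  shows "(\<Sum>i<N. if (\<Sum>j\<le>i. a j) \<le> \<eta> then a i else 0) \<le> \<eta>"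
proof (induction N)
  case (Suc N)
  show ?case
  proof (cases "(\<Sum>j\<le>N. a j) \<le> \<eta>")
    case True
    have "(\<Sum>i<Suc N. if (\<Sum>j\<le>i. a j) \<le> \<eta> then a i else 0) \<le> (\<Sum>i<Suc N. a i)"
      using assms by (intro sum_mono) auto
    then show ?thesis using True by (simp add: lessThan_Suc_atMost)
  qed (use Suc in simp)
qed (use assms in simp)

lemma finite_strict_mono_enumeration:
  fixes P :: "'b::linorder set"
  assumes "finite P" "P \<noteq> {}"
  obtains q N where "strict_mono_on {..N::nat} q" "q ` {..N} = P"
proof
  let ?l = "sorted_list_of_set P"
  have len: "length ?l = Suc (card P - 1)"
    using assms by (simp add: card_gt_0_iff)
  then have set: "{..card P - 1} = {..<length ?l}" by auto
  show "strict_mono_on {..card P - 1} ((!) ?l)"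
    unfolding set using strict_sorted_list_of_set[of P]
    by (auto intro!: strict_mono_onI simp: sorted_wrt_iff_nth_less)
  show "(!) ?l ` {..card P - 1} = P"
    unfolding set using set_conv_nth[of ?l] assms by (auto simp: image_def)
qed

text \<open>The hypothesis says that no time of the process lies strictly inside the cell. The
  constant value is read off at the right endpoint \<open>v\<close> because the intervals of a
  simple process are open on the left; the value at \<open>u\<close> belongs to the cell
  before.\<close>

lemma simple_process_cell:
  assumes "\<And>i. i < n \<Longrightarrow> \<tau> i < \<tau> (Suc i)" and "\<And>i. i \<le> n \<Longrightarrow> \<tau> i \<le> u \<or> v \<le> \<tau> i" and "s \<in> {u<..v}"
  shows "simple_process n \<tau> \<xi> s \<omega> = simple_process n \<tau> \<xi> v \<omega>"
    and "simple_integral W n \<tau> \<xi> v \<omega> - simple_integral W n \<tau> \<xi> u \<omega>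
          = simple_process n \<tau> \<xi> v \<omega> * (W v \<omega> - W u \<omega>)"
proof -
  have cell: "\<tau> i \<le> u \<or> v \<le> \<tau> i" "\<tau> (Suc i) \<le> u \<or> v \<le> \<tau> (Suc i)" "\<tau> i < \<tau> (Suc i)" if "i < n" for i
    using assms(1)[of i] assms(2)[of i] assms(2)[of "Suc i"] that by auto
  show "simple_process n \<tau> \<xi> s \<omega> = simple_process n \<tau> \<xi> v \<omega>"
    unfolding simple_process_def
  proof (intro sum.cong refl arg_cong2[where f="(*)"])
    fix i assume "i \<in> {..<n}"
    then show "indicator {\<tau> i<..\<tau> (Suc i)} s = (indicator {\<tau> i<..\<tau> (Suc i)} v :: real)"
      using cell[of i] assms(3) by (auto split: split_indicator)
  qed
  show "simple_integral W n \<tau> \<xi> v \<omega> - simple_integral W n \<tau> \<xi> u \<omega>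
          = simple_process n \<tau> \<xi> v \<omega> * (W v \<omega> - W u \<omega>)"
    unfolding simple_process_def simple_integral_def sum_subtractf[symmetric] sum_distrib_right
  proof (intro sum.cong refl)
    fix i assume "i \<in> {..<n}"
    then consider "\<tau> (Suc i) \<le> u" "\<tau> i \<le> u" | "v \<le> \<tau> i" "v \<le> \<tau> (Suc i)" | "\<tau> i \<le> u" "v \<le> \<tau> (Suc i)"
      using cell[of i] by force
    then show "\<xi> i \<omega> * (W (min (\<tau> (Suc i)) v) \<omega> - W (min (\<tau> i) v) \<omega>)
        - \<xi> i \<omega> * (W (min (\<tau> (Suc i)) u) \<omega> - W (min (\<tau> i) u) \<omega>)
        = \<xi> i \<omega> * indicator {\<tau> i<..\<tau> (Suc i)} v * (W v \<omega> - W u \<omega>)"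
      using assms(3) by cases (auto simp: min_absorb1 min_absorb2 algebra_simps split: split_indicator)
  qed
qed

lemma integrable_bounded_mult:
  fixes f X :: "'a \<Rightarrow> real"
  assumes "f \<in> borel_measurable M" "\<exists>B. \<forall>\<omega>\<in>space M. \<bar>f \<omega>\<bar> \<le> B" and X: "integrable M X"
  shows "integrable M (\<lambda>\<omega>. f \<omega> * X \<omega>)"
proof -
  obtain B where B: "\<And>\<omega>. \<omega> \<in> space M \<Longrightarrow> \<bar>f \<omega>\<bar> \<le> B" using assms(2) by auto
  show ?thesis
  proof (rule Bochner_Integration.integrable_bound)
    show "integrable M (\<lambda>\<omega>. B * \<bar>X \<omega>\<bar>)" using X by simp
    show "(\<lambda>\<omega>. f \<omega> * X \<omega>) \<in> borel_measurable M"
      using assms(1) X by (intro borel_measurable_times) auto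
    show "AE \<omega> in M. norm (f \<omega> * X \<omega>) \<le> norm (B * \<bar>X \<omega>\<bar>)"
    proof (rule AE_I2)
      fix \<omega> assume "\<omega> \<in> space M"
      then have "\<bar>f \<omega>\<bar> \<le> \<bar>B\<bar>" using B by fastforce
      then show "norm (f \<omega> * X \<omega>) \<le> norm (B * \<bar>X \<omega>\<bar>)"
        by (simp add: abs_mult mult_right_mono)
    qed
  qed
qed

section \<open>Ito isometry and a Lenglart-type inequality on a deterministic grid\<close>

context wiener_space
begin

context
  fixes q :: "nat \<Rightarrow> real" and N :: nat
  assumes q: "mono_on {..N} q" "0 \<le> q 0"
begin

private lemma q_le: "i \<le> j \<Longrightarrow> j \<le> N \<Longrightarrow> q i \<le> q j"
  using q(1) by (auto simp: mono_on_def)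

private lemma q_nonneg: "i \<le> N \<Longrightarrow> 0 \<le> q i"
  using q_le[of 0 i] q(2) by simp

text \<open>In a cross term the later increment has mean 0 and is independent of all other factors,
  which are known at its left endpoint. The sum runs over a subset \<open>A\<close> of the cells so
  that the isometry can be applied to each dyadic block separately.\<close>

lemma discrete_ito_isometry:
  assumes A: "A \<subseteq> {..<N}"
    and g: "\<And>i. i < N \<Longrightarrow> g i \<in> borel_measurable (F (q i))"
    and bd: "\<And>i. i < N \<Longrightarrow> \<exists>B. \<forall>\<omega>\<in>space M. \<bar>g i \<omega>\<bar> \<le> B"
  shows "integrable M (\<lambda>\<omega>. (\<Sum>i\<in>A. g i \<omega> * (W (q (Suc i)) \<omega> - W (q i) \<omega>))\<^sup>2)"
    and "expectation (\<lambda>\<omega>. (\<Sum>i\<in>A. g i \<omega> * (W (q (Suc i)) \<omega> - W (q i) \<omega>))\<^sup>2)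
           = (\<Sum>i\<in>A. expectation (\<lambda>\<omega>. (g i \<omega>)\<^sup>2) * (q (Suc i) - q i))"
proof -
  define D where "D = (\<lambda>i \<omega>. W (q (Suc i)) \<omega> - W (q i) \<omega>)"
  define Y where "Y = (\<lambda>i \<omega>. g i \<omega> * D i \<omega>)"
  have gM: "g i \<in> borel_measurable M" if "i < N" for i using F_measurable_M[OF g] that .
  have D_int: "integrable M (\<lambda>\<omega>. D i \<omega> ^ k)" if "i < N" for i k
    unfolding D_def using that q_le q_nonneg by (intro increment_moments) auto
  have D_int1: "integrable M (D i)" if "i < N" for i
    using D_int[OF that, of 1] by simp
  have Y_int: "integrable M (Y i)" if "i < N" for i
    unfolding Y_def using that by (intro integrable_bounded_mult gM bd D_int1)
  have DF: "D i \<in> borel_measurable (F (q j))" if "i < j" "j < N" for i j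
    unfolding D_def using that q_le q_nonneg by (intro borel_measurable_diff W_measurable_F) auto
  have *: "integrable M (\<lambda>\<omega>. Y i \<omega> * Y j \<omega>) \<and> expectation (\<lambda>\<omega>. Y i \<omega> * Y j \<omega>) = 0"
    if "i < j" "j < N" for i j
  proof -
    let ?Z = "\<lambda>\<omega>. g j \<omega> * Y i \<omega>"
    have "?Z \<in> borel_measurable (F (q j))"
      unfolding Y_def using that q_le[of i j]
      by (intro borel_measurable_times g DF F_measurable_mono[of "q i" "q j" "g i"]) auto
    moreover have "integrable M ?Z"
      using that by (intro integrable_bounded_mult gM bd Y_int) auto
    moreover have "expectation (D j) = 0"
      unfolding D_def using that q_le q_nonneg by (intro increment_moments) auto
    ultimately show ?thesis
      using expectation_mult_increment[of "q j" "q (Suc j)" ?Z "\<lambda>x. x"] that q_le q_nonneg D_int1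
      by (simp add: D_def Y_def mult_ac)
  qed
  have sq: "integrable M (\<lambda>\<omega>. (Y i \<omega>)\<^sup>2) \<and> expectation (\<lambda>\<omega>. (Y i \<omega>)\<^sup>2) = expectation (\<lambda>\<omega>. (g i \<omega>)\<^sup>2) * (q (Suc i) - q i)"
    if i: "i < N" for i
  proof -
    obtain B where B: "\<And>\<omega>. \<omega> \<in> space M \<Longrightarrow> \<bar>g i \<omega>\<bar> \<le> B" using bd[OF i] by auto
    have "integrable M (\<lambda>\<omega>. (g i \<omega>)\<^sup>2)"
    proof (rule integrable_const_bound[of _ "B\<^sup>2"])
      show "AE \<omega> in M. norm ((g i \<omega>)\<^sup>2) \<le> B\<^sup>2"
        using power_mono[OF B, of _ 2] by (intro AE_I2) simp
    qed (use gM[OF i] in simp)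
    moreover have "expectation (\<lambda>\<omega>. (D i \<omega>)\<^sup>2) = q (Suc i) - q i"
      unfolding D_def using that q_le q_nonneg by (intro increment_moments) auto
    ultimately show ?thesis
      using expectation_mult_increment[of "q i" "q (Suc i)" "\<lambda>\<omega>. (g i \<omega>)\<^sup>2" "\<lambda>x. x\<^sup>2"]
        that q_le q_nonneg D_int[OF i, of 2] g[OF i]
      by (simp add: D_def Y_def power_mult_distrib)
  qed
  have int: "integrable M (\<lambda>\<omega>. Y i \<omega> * Y j \<omega>)" if "i < N" "j < N" for i j
    using *[of i j] *[of j i] sq[of i] that
    by (cases i j rule: linorder_cases) (auto simp: mult.commute power2_eq_square)
  have orth: "expectation (\<lambda>\<omega>. Y i \<omega> * Y j \<omega>) = 0" if "i < N" "j < N" "i \<noteq> j" for i j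
    using *[of i j] *[of j i] that by (cases "i < j") (auto simp: mult.commute)
  have "finite A" using A finite_subset by blast
  note sum = orthogonal_sum_square[where M=M and Y=Y, OF this]
  have "integrable M (\<lambda>\<omega>. (\<Sum>i\<in>A. Y i \<omega>)\<^sup>2)"
    by (rule sum) (use A in \<open>auto intro!: int orth\<close>)
  moreover have "expectation (\<lambda>\<omega>. (\<Sum>i\<in>A. Y i \<omega>)\<^sup>2) = (\<Sum>i\<in>A. expectation (\<lambda>\<omega>. (Y i \<omega>)\<^sup>2))"
    by (rule sum) (use A in \<open>auto intro!: int orth\<close>)
  moreover have "\<dots> = (\<Sum>i\<in>A. expectation (\<lambda>\<omega>. (g i \<omega>)\<^sup>2) * (q (Suc i) - q i))"
    using sq A by (intro sum.cong) auto
  ultimately show "integrable M (\<lambda>\<omega>. (\<Sum>i\<in>A. g i \<omega> * (W (q (Suc i)) \<omega> - W (q i) \<omega>))\<^sup>2)"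
    "expectation (\<lambda>\<omega>. (\<Sum>i\<in>A. g i \<omega> * (W (q (Suc i)) \<omega> - W (q i) \<omega>))\<^sup>2)
           = (\<Sum>i\<in>A. expectation (\<lambda>\<omega>. (g i \<omega>)\<^sup>2) * (q (Suc i) - q i))"
    unfolding Y_def D_def by auto
qed

text \<open>Truncation caps the sum of \<open>(g i \<omega>)\<^sup>2 * (q (Suc i) - q i)\<close> at
  \<open>\<eta>\<close> everywhere and changes nothing outside \<open>E\<close>; the isometry and
  Markov's inequality then give \<open>\<eta> / \<epsilon>\<close>. The blocks \<open>A k\<close>
  will be the dyadic intervals.\<close>

lemma discrete_lenglart:
  assumes g: "\<And>i. i < N \<Longrightarrow> g i \<in> borel_measurable (F (q i))"
    and bd: "\<And>i. i < N \<Longrightarrow> \<exists>B. \<forall>\<omega>\<in>space M. \<bar>g i \<omega>\<bar> \<le> B"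
    and K: "finite K" "\<And>k. k \<in> K \<Longrightarrow> A k \<subseteq> {..<N}" "disjoint_family_on A K"
    and "0 \<le> \<eta>" "0 < \<epsilon>" and E: "E \<in> events"
    and small: "\<And>\<omega>. \<omega> \<in> space M - E \<Longrightarrow> (\<Sum>i<N. (g i \<omega>)\<^sup>2 * (q (Suc i) - q i)) \<le> \<eta>"
  shows "prob {\<omega> \<in> space M. (\<Sum>k\<in>K. (\<Sum>i\<in>A k. g i \<omega> * (W (q (Suc i)) \<omega> - W (q i) \<omega>))\<^sup>2) > \<epsilon>}
          \<le> prob E + \<eta> / \<epsilon>"
proof -
  define c where "c = (\<lambda>\<omega> i. if i < N then (g i \<omega>)\<^sup>2 * (q (Suc i) - q i) else 0)"
  \<comment> \<open>The truncation condition at \<open>i\<close> involves only \<open>g 0, \<dots>, g i\<close>, so \<open>h i\<close> is still known at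
    time \<open>q i\<close>.\<close>
  define h where "h = (\<lambda>i \<omega>. if (\<Sum>j\<le>i. c \<omega> j) \<le> \<eta> then g i \<omega> else 0)"
  define S where "S = (\<lambda>f \<omega>. \<Sum>k\<in>K. (\<Sum>i\<in>A k. f i \<omega> * (W (q (Suc i)) \<omega> - W (q i) \<omega>))\<^sup>2)"
  have c_nn: "0 \<le> c \<omega> i" for \<omega> i
    using q_le[of i "Suc i"] by (simp add: c_def)
  have hF: "h i \<in> borel_measurable (F (q i))" if "i < N" for i
  proof -
    have [measurable]: "g j \<in> borel_measurable (F (q i))" if "j \<le> i" for j
      using that \<open>i < N\<close> q_le by (intro F_measurable_mono[of "q j" "q i" "g j"] g) auto
    have [measurable]: "g i \<in> borel_measurable (F (q i))" using g[OF that] .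
    have "(\<lambda>\<omega>. \<Sum>j\<le>i. c \<omega> j) \<in> borel_measurable (F (q i))"
      unfolding c_def using that by (intro borel_measurable_sum) simp
    then show ?thesis unfolding h_def by measurable
  qed
  have hbd: "\<exists>B. \<forall>\<omega>\<in>space M. \<bar>h i \<omega>\<bar> \<le> B" if i: "i < N" for i
  proof -
    obtain B where B: "\<And>\<omega>. \<omega> \<in> space M \<Longrightarrow> \<bar>g i \<omega>\<bar> \<le> B" using bd[OF i] by auto
    have "\<bar>h i \<omega>\<bar> \<le> \<bar>B\<bar>" if "\<omega> \<in> space M" for \<omega>
      using B[OF that] by (auto simp: h_def)
    then show ?thesis by blast
  qed
  note iso = discrete_ito_isometry[OF K(2) hF hbd]
  have int: "integrable M (S h)"
    unfolding S_def by (intro Bochner_Integration.integrable_sum iso)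
  have hsq_int: "integrable M (\<lambda>\<omega>. (h i \<omega>)\<^sup>2)" if i: "i < N" for i
  proof -
    obtain B where B: "\<And>\<omega>. \<omega> \<in> space M \<Longrightarrow> \<bar>h i \<omega>\<bar> \<le> B" using hbd[OF i] by auto
    show ?thesis
    proof (rule integrable_const_bound[of _ "B\<^sup>2"])
      show "AE \<omega> in M. norm ((h i \<omega>)\<^sup>2) \<le> B\<^sup>2"
        using power_mono[OF B, of _ 2] by (intro AE_I2) simp
    qed (use F_measurable_M[OF hF[OF i]] in simp)
  qed
  have "expectation (S h) = (\<Sum>k\<in>K. \<Sum>i\<in>A k. expectation (\<lambda>\<omega>. (h i \<omega>)\<^sup>2) * (q (Suc i) - q i))"
    unfolding S_def by (simp add: iso)
  \<comment> \<open>Here the grouping into blocks disappears, so the bound is the same for every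
    mesh.\<close>
  also have "\<dots> = (\<Sum>i\<in>(\<Union>k\<in>K. A k). expectation (\<lambda>\<omega>. (h i \<omega>)\<^sup>2) * (q (Suc i) - q i))"
    using K finite_subset[OF K(2)]
    by (intro sum.UNION_disjoint[symmetric]) (auto simp: disjoint_family_on_def)
  also have "\<dots> \<le> (\<Sum>i<N. expectation (\<lambda>\<omega>. (h i \<omega>)\<^sup>2) * (q (Suc i) - q i))"
    using K q_le by (intro sum_mono2) (auto intro!: mult_nonneg_nonneg Bochner_Integration.integral_nonneg)
  also have "\<dots> = expectation (\<lambda>\<omega>. \<Sum>i<N. (h i \<omega>)\<^sup>2 * (q (Suc i) - q i))"
    using hsq_int by (simp add: Bochner_Integration.integral_sum)
  also have "\<dots> \<le> expectation (\<lambda>\<omega>. \<eta>)"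
  proof (rule integral_mono)
    fix \<omega>
    have "(\<Sum>i<N. (h i \<omega>)\<^sup>2 * (q (Suc i) - q i)) = (\<Sum>i<N. if (\<Sum>j\<le>i. c \<omega> j) \<le> \<eta> then c \<omega> i else 0)"
      by (intro sum.cong refl) (auto simp: h_def c_def)
    also have "\<dots> \<le> \<eta>" using c_nn \<open>0 \<le> \<eta>\<close> by (rule truncated_sum_le)
    finally show "(\<Sum>i<N. (h i \<omega>)\<^sup>2 * (q (Suc i) - q i)) \<le> \<eta>" .
  qed (use hsq_int in \<open>auto intro!: Bochner_Integration.integrable_sum\<close>)
  finally have exp: "expectation (S h) \<le> \<eta>" by (simp add: prob_space)
  have Sm [measurable]: "S h \<in> borel_measurable M" using int by auto
  have "S g \<omega> = S h \<omega>" if "\<omega> \<in> space M - E" for \<omega>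
  proof -
    have "(\<Sum>j\<le>i. c \<omega> j) \<le> \<eta>" if "i < N" for i
    proof -
      have "(\<Sum>j\<le>i. c \<omega> j) \<le> (\<Sum>j<N. c \<omega> j)" using that c_nn by (intro sum_mono2) auto
      also have "\<dots> \<le> \<eta>" using small[OF \<open>\<omega> \<in> space M - E\<close>] by (simp add: c_def)
      finally show ?thesis .
    qed
    then have "g i \<omega> = h i \<omega>" if "i < N" for i using that by (simp add: h_def)
    then show ?thesis unfolding S_def using K(2)
      by (intro sum.cong refl arg_cong[where f="\<lambda>x. x\<^sup>2"] arg_cong2[where f="(*)"]) auto
  qed
  then have "prob {\<omega> \<in> space M. S g \<omega> > \<epsilon>} \<le> prob (E \<union> {\<omega> \<in> space M. \<epsilon> \<le> S h \<omega>})"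
    using E by (intro finite_measure_mono) (force, intro sets.Un, auto)
  also have "\<dots> \<le> prob E + prob {\<omega> \<in> space M. \<epsilon> \<le> S h \<omega>}"
    using E by (intro measure_Un_le) auto
  also have "prob {\<omega> \<in> space M. \<epsilon> \<le> S h \<omega>} \<le> expectation (S h) / \<epsilon>"
    using int \<open>0 < \<epsilon>\<close> by (intro integral_Markov_inequality_measure[of _ _ "{}"]) (auto simp: S_def intro!: AE_I2 sum_nonneg)
  also have "\<dots> \<le> \<eta> / \<epsilon>" using exp \<open>0 < \<epsilon>\<close> by (simp add: divide_right_mono)
  finally show ?thesis by (simp add: S_def)
qed

end

text \<open>Only intervals begun before \<open>v\<close> contribute at \<open>v\<close>, and by
  hypothesis these have begun by \<open>u\<close>, when their coefficients are known. So on a cell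
  of the grid the value at the right endpoint is an admissible coefficient for the left one.\<close>

lemma simple_process_measurable_F:
  assumes "simple_integrand F n \<tau> \<xi>" and "\<And>i. i < n \<Longrightarrow> \<tau> i < v \<Longrightarrow> \<tau> i \<le> u"
  shows "simple_process n \<tau> \<xi> v \<in> borel_measurable (F u)"
    and "\<exists>B. \<forall>\<omega>\<in>space M. \<bar>simple_process n \<tau> \<xi> v \<omega>\<bar> \<le> B"
proof -
  have "(\<lambda>\<omega>. \<Sum>i<n. \<xi> i \<omega> * indicator {\<tau> i<..\<tau> (Suc i)} v) \<in> borel_measurable (F u)"
  proof (rule borel_measurable_sum)
    fix i assume "i \<in> {..<n}"
    then show "(\<lambda>\<omega>. \<xi> i \<omega> * indicator {\<tau> i<..\<tau> (Suc i)} v) \<in> borel_measurable (F u)"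
      using assms F_measurable_mono[of "\<tau> i" u "\<xi> i"]
      by (cases "\<tau> i < v") (auto simp: simple_integrand_def)
  qed
  then show "simple_process n \<tau> \<xi> v \<in> borel_measurable (F u)"
    by (simp add: simple_process_def[abs_def])
  have "\<exists>B. \<forall>\<omega>\<in>space M. \<bar>\<xi> i \<omega>\<bar> \<le> B" if "i < n" for i
    using assms(1) that by (simp add: simple_integrand_def)
  then obtain B where B: "\<And>i \<omega>. i < n \<Longrightarrow> \<omega> \<in> space M \<Longrightarrow> \<bar>\<xi> i \<omega>\<bar> \<le> B i" by metis
  have "\<bar>simple_process n \<tau> \<xi> v \<omega>\<bar> \<le> (\<Sum>i<n. B i)" if "\<omega> \<in> space M" for \<omega>
  proof -
    have "\<bar>\<xi> i \<omega> * indicator {\<tau> i<..\<tau> (Suc i)} v\<bar> \<le> B i" if "i < n" for i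
      using B[OF that \<open>\<omega> \<in> space M\<close>] by (auto split: split_indicator)
    then show ?thesis unfolding simple_process_def
      by (intro order.trans[OF sum_abs] sum_mono) auto
  qed
  then show "\<exists>B. \<forall>\<omega>\<in>space M. \<bar>simple_process n \<tau> \<xi> v \<omega>\<bar> \<le> B" by blast
qed

text \<open>On the common refinement of both families of times and the dyadic points, the difference
  of the integrands is constant on cells, and each dyadic increment of the difference of the
  integrals is a sum over a block of cells, so \<open>discrete_lenglart\<close> applies. The
  right-hand side is free of \<open>m\<close>.\<close>

lemma simple_integrals_dyadic_lenglart:
  assumes s: "simple_integrand F n \<tau> \<xi>" and s': "simple_integrand F n' \<tau>' \<xi>'"
    and "0 \<le> t" "0 \<le> \<eta>" "0 < \<epsilon>" and E: "E \<in> events"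
    and small: "\<And>\<omega>. \<omega> \<in> space M - E \<Longrightarrow>
      (\<integral>\<^sup>+ s\<in>{0..t}. ennreal ((simple_process n \<tau> \<xi> s \<omega> - simple_process n' \<tau>' \<xi>' s \<omega>)\<^sup>2) \<partial>lborel) \<le> ennreal \<eta>"
  shows "prob {\<omega> \<in> space M.
      dyadic_sq_sum (\<lambda>x. simple_integral W n \<tau> \<xi> x \<omega> - simple_integral W n' \<tau>' \<xi>' x \<omega>) t m > \<epsilon>}
    \<le> prob E + \<eta> / \<epsilon>"
proof -
  define d where "d = (\<lambda>k. real k * t / 2 ^ m)"
  define P where "P = (\<lambda>i. min (\<tau> i) t) ` {..n} \<union> (\<lambda>i. min (\<tau>' i) t) ` {..n'} \<union> d ` {..2 ^ m}"
  have "finite P" "P \<noteq> {}" by (auto simp: P_def)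
  then obtain q and N :: nat where q: "strict_mono_on {..N} q" "q ` {..N} = P"
    by (rule finite_strict_mono_enumeration)
  have d_le: "d k \<le> t" if "k \<le> 2 ^ m" for k
  proof -
    have "real k \<le> 2 ^ m" using that by (metis of_nat_le_iff of_nat_numeral of_nat_power)
    then show ?thesis using \<open>0 \<le> t\<close> by (simp add: d_def field_simps mult_left_mono)
  qed
  have P: "0 \<le> x" "x \<le> t" if "x \<in> P" for x
    using that \<open>0 \<le> t\<close> simple_integrand_times(3)[OF s] simple_integrand_times(3)[OF s'] d_le
    by (auto simp: P_def) (auto simp: d_def)
  have qP: "q i \<in> P" if "i \<le> N" for i using q(2) that by auto
  have q_less: "q i < q j" if "i < j" "j \<le> N" for i j
    using q(1) that by (auto simp: strict_mono_on_def)
  have q_mono: "mono_on {..N} q" using q(1) by (rule strict_mono_on_imp_mono_on)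
  have q0: "0 \<le> q 0" using P qP by auto
  \<comment> \<open>A time \<open>x > t\<close> is represented by the grid point \<open>t\<close>;
    no cell extends beyond \<open>t\<close>, so \<open>x\<close> does not lie inside a cell
    either.\<close>
  have cell: "x \<le> q i \<or> q (Suc i) \<le> x" if "i < N" "min x t \<in> P" for i x
  proof -
    have "min x t \<in> q ` {..N}" using q(2) that by simp
    then obtain j where j: "j \<le> N" "min x t = q j" by auto
    have "q j \<le> q i \<or> q (Suc i) \<le> q j"
      using q_mono j(1) that(1) by (cases "j \<le> i") (auto simp: mono_on_def)
    moreover have "q (Suc i) \<le> t" "q i < q (Suc i)" using P qP that q_less[of i "Suc i"] by auto
    ultimately show ?thesis using j(2) by (auto simp: min_def split: if_splits)
  qed
  have cell1: "\<tau> l \<le> q i \<or> q (Suc i) \<le> \<tau> l" if "i < N" "l \<le> n" for i l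
    using that by (intro cell) (auto simp: P_def)
  have cell2: "\<tau>' l \<le> q i \<or> q (Suc i) \<le> \<tau>' l" if "i < N" "l \<le> n'" for i l
    using that by (intro cell) (auto simp: P_def)
  note incr = simple_integrand_times(1)[OF s] and incr' = simple_integrand_times(1)[OF s']
  define G where "G = (\<lambda>s \<omega>. simple_process n \<tau> \<xi> s \<omega> - simple_process n' \<tau>' \<xi>' s \<omega>)"
  define g where "g = (\<lambda>i. G (q (Suc i)))"
  define J where "J = (\<lambda>x \<omega>. simple_integral W n \<tau> \<xi> x \<omega> - simple_integral W n' \<tau>' \<xi>' x \<omega>)"
  have G_cell: "G s \<omega> = g i \<omega>" if "i < N" "s \<in> {q i<..q (Suc i)}" for i s \<omega>
    unfolding G_def g_def
    using simple_process_cell(1)[where n=n and \<tau>=\<tau>, OF incr cell1[OF that(1)] that(2), of \<xi> \<omega>]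
      simple_process_cell(1)[where n=n' and \<tau>=\<tau>', OF incr' cell2[OF that(1)] that(2), of \<xi>' \<omega>] by simp
  have J_cell: "J (q (Suc i)) \<omega> - J (q i) \<omega> = g i \<omega> * (W (q (Suc i)) \<omega> - W (q i) \<omega>)" if "i < N" for i \<omega>
  proof -
    have mem: "q (Suc i) \<in> {q i<..q (Suc i)}" using q_less that by auto
    show ?thesis
      using simple_process_cell(2)[where n=n and \<tau>=\<tau>, OF incr cell1[OF that] mem, of W \<xi> \<omega>]
        simple_process_cell(2)[where n=n' and \<tau>=\<tau>', OF incr' cell2[OF that] mem, of W \<xi>' \<omega>]
      unfolding J_def g_def G_def by (simp add: algebra_simps)
  qed
  have gF: "g i \<in> borel_measurable (F (q i))" if "i < N" for i
    unfolding g_def G_def using cell1[OF that] cell2[OF that]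
    by (intro borel_measurable_diff simple_process_measurable_F[OF s] simple_process_measurable_F[OF s'])
       (meson less_imp_le not_le)+
  have gbd: "\<exists>B. \<forall>\<omega>\<in>space M. \<bar>g i \<omega>\<bar> \<le> B" if "i < N" for i
  proof -
    obtain B where B: "\<And>\<omega>. \<omega> \<in> space M \<Longrightarrow> \<bar>simple_process n \<tau> \<xi> (q (Suc i)) \<omega>\<bar> \<le> B"
      using simple_process_measurable_F(2)[OF s] by (metis less_imp_le)
    obtain B' where B': "\<And>\<omega>. \<omega> \<in> space M \<Longrightarrow> \<bar>simple_process n' \<tau>' \<xi>' (q (Suc i)) \<omega>\<bar> \<le> B'"
      using simple_process_measurable_F(2)[OF s'] by (metis less_imp_le)
    have "\<bar>g i \<omega>\<bar> \<le> B + B'" if "\<omega> \<in> space M" for \<omega>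
      using B[OF that] B'[OF that] unfolding g_def G_def by linarith
    then show ?thesis by blast
  qed
  have "\<forall>k\<in>{..2 ^ m}. \<exists>i\<le>N. q i = d k"
  proof
    fix k assume "k \<in> {..(2::nat) ^ m}"
    then have "d k \<in> q ` {..N}" using q(2) by (auto simp: P_def)
    then show "\<exists>i\<le>N. q i = d k" by force
  qed
  \<comment> \<open>\<open>a k\<close> is the position of the \<open>k\<close>-th dyadic point in
    the grid, so the \<open>k\<close>-th block consists of the cells \<open>a k\<close> to
    \<open>a (Suc k) - 1\<close>.\<close>
  then obtain a where a: "\<And>k. k \<le> 2 ^ m \<Longrightarrow> a k \<le> N" "\<And>k. k \<le> 2 ^ m \<Longrightarrow> q (a k) = d k"
    by (metis atMost_iff)
  have a_mono: "a k \<le> a l" if "k \<le> l" "l \<le> 2 ^ m" for k l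
  proof (rule ccontr)
    assume "\<not> a k \<le> a l"
    then have "q (a l) < q (a k)" using q_less a(1) that by auto
    then have "d l < d k" using a(2) that by auto
    moreover have "d k \<le> d l"
      unfolding d_def using that \<open>0 \<le> t\<close> by (intro divide_right_mono mult_right_mono) auto
    ultimately show False by simp
  qed
  define A where "A = (\<lambda>k. {a k..<a (Suc k)})"
  have disj: "disjoint_family_on A {..<2 ^ m}"
    unfolding disjoint_family_on_def
  proof (intro ballI impI)
    fix k l :: nat assume "k \<in> {..<2 ^ m}" "l \<in> {..<2 ^ m}" "k \<noteq> l"
    then have "a (Suc k) \<le> a l \<or> a (Suc l) \<le> a k"
      using a_mono[of "Suc k" l] a_mono[of "Suc l" k] by (cases "k < l") auto
    then show "A k \<inter> A l = {}" by (auto simp: A_def)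
  qed
  have A_sub: "A k \<subseteq> {..<N}" if "k \<in> {..<2 ^ m}" for k
    using a(1)[of "Suc k"] that by (auto simp: A_def)
  have J_sum: "dyadic_sq_sum (\<lambda>x. J x \<omega>) t m =
     (\<Sum>k<2 ^ m. (\<Sum>i\<in>A k. g i \<omega> * (W (q (Suc i)) \<omega> - W (q i) \<omega>))\<^sup>2)" for \<omega>
    unfolding dyadic_sq_sum_eq
  proof (intro sum.cong refl arg_cong[where f="\<lambda>x. x\<^sup>2"])
    fix k assume k: "k \<in> {..<(2::nat) ^ m}"
    have "dyadic_incr (\<lambda>x. J x \<omega>) t m k = J (q (a (Suc k))) \<omega> - J (q (a k)) \<omega>"
      using a(2)[of k] a(2)[of "Suc k"] k by (simp add: dyadic_incr_def d_def)
    also have "\<dots> = (\<Sum>i\<in>A k. J (q (Suc i)) \<omega> - J (q i) \<omega>)"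
      unfolding A_def using a_mono[of k "Suc k"] k by (subst sum_Suc_diff') auto
    also have "\<dots> = (\<Sum>i\<in>A k. g i \<omega> * (W (q (Suc i)) \<omega> - W (q i) \<omega>))"
      using A_sub[OF k] by (intro sum.cong refl J_cell) auto
    finally show "dyadic_incr (\<lambda>x. J x \<omega>) t m k = (\<Sum>i\<in>A k. g i \<omega> * (W (q (Suc i)) \<omega> - W (q i) \<omega>))" .
  qed
  have "(\<Sum>i<N. (g i \<omega>)\<^sup>2 * (q (Suc i) - q i)) \<le> \<eta>" if "\<omega> \<in> space M - E" for \<omega>
  proof -
    have qd: "0 \<le> q (Suc i) - q i" if "i < N" for i using q_less[of i "Suc i"] that by simp
    \<comment> \<open>The cells are disjoint and \<open>G\<close> is constant on each, so the sum is
      the integral of \<open>(G s \<omega>)\<^sup>2\<close> over their union, which lies in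
      \<open>[0,t]\<close>. The comparison takes place in the extended reals, where
      \<open>small\<close> is stated.\<close>
    have "ennreal (\<Sum>i<N. (g i \<omega>)\<^sup>2 * (q (Suc i) - q i)) = (\<Sum>i<N. ennreal ((g i \<omega>)\<^sup>2) * emeasure lborel {q i<..q (Suc i)})"
      using qd by (subst sum_ennreal[symmetric]) (auto simp: ennreal_mult intro!: sum.cong)
    also have "\<dots> = (\<integral>\<^sup>+s. (\<Sum>i<N. ennreal ((g i \<omega>)\<^sup>2) * indicator {q i<..q (Suc i)} s) \<partial>lborel)"
      by (subst nn_integral_sum, measurable)
         (intro sum.cong refl nn_integral_cmult_indicator[symmetric], simp)
    also have "\<dots> \<le> (\<integral>\<^sup>+s\<in>{0..t}. ennreal ((G s \<omega>)\<^sup>2) \<partial>lborel)"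
    proof (rule nn_integral_mono)
      fix s
      show "(\<Sum>i<N. ennreal ((g i \<omega>)\<^sup>2) * indicator {q i<..q (Suc i)} s) \<le> ennreal ((G s \<omega>)\<^sup>2) * indicator {0..t} s"
      proof (cases "\<exists>i<N. s \<in> {q i<..q (Suc i)}")
        case True
        then obtain i where i: "i < N" "s \<in> {q i<..q (Suc i)}" by auto
        have "s \<notin> {q j<..q (Suc j)}" if "j < N" "j \<noteq> i" for j
        proof (cases "j < i")
          case True
          then have "q (Suc j) \<le> q i" using q_mono i(1) by (auto simp: mono_on_def)
          then show ?thesis using i by auto
        next
          case False
          then have "q (Suc i) \<le> q j" using q_mono that i(1) by (auto simp: mono_on_def)
          then show ?thesis using i by auto
        qed
        then have "(\<Sum>j<N. ennreal ((g j \<omega>)\<^sup>2) * indicator {q j<..q (Suc j)} s) =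
            (\<Sum>j<N. if j = i then ennreal ((g i \<omega>)\<^sup>2) else 0)"
          using i by (intro sum.cong refl) auto
        also have "\<dots> = ennreal ((G s \<omega>)\<^sup>2)" using i G_cell by simp
        finally show ?thesis
          using i P(1)[OF qP[of i]] P(2)[OF qP[of "Suc i"]] by (auto split: split_indicator)
      next
        case False
        then have "(\<Sum>i<N. ennreal ((g i \<omega>)\<^sup>2) * indicator {q i<..q (Suc i)} s) = 0"
          by (intro sum.neutral) (auto split: split_indicator)
        then show ?thesis by simp
      qed
    qed
    also have "\<dots> \<le> ennreal \<eta>" using small[OF that] by (simp add: G_def)
    finally show ?thesis using \<open>0 \<le> \<eta>\<close> by simp
  qed
  from discrete_lenglart[OF q_mono q0 gF gbd _ A_sub disj \<open>0 \<le> \<eta>\<close> \<open>0 < \<epsilon>\<close> E this]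
  show ?thesis by (simp add: J_sum[symmetric, unfolded J_def])
qed

end

section \<open>Quadratic variation of an Ito integral\<close>

lemma square_diff_le:
  fixes a b c :: real
  shows "(a - b)\<^sup>2 \<le> 2 * (a - c)\<^sup>2 + 2 * (b - c)\<^sup>2"
proof -
  \<comment> \<open>By the parallelogram law this square is the difference of the two sides.\<close>
  have "0 \<le> (a + b - 2 * c)\<^sup>2" by simp
  then show ?thesis by (simp add: power2_eq_square algebra_simps)
qed

text \<open>Young's inequality \<open>2 * \<bar>b * (a - b)\<bar> \<le> c * b\<^sup>2 + (a -
  b)\<^sup>2 / c\<close>. The free weight \<open>c\<close> makes the share of
  \<open>b\<^sup>2\<close> small at the cost of a large factor on \<open>(a - b)\<^sup>2\<close>,
  which can be made smaller still. Being linear in the squares, the bound can be integrated and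
  summed termwise.\<close>

lemma abs_diff_squares_le:
  fixes a b c :: real
  assumes "0 < c"
  shows "\<bar>a\<^sup>2 - b\<^sup>2\<bar> \<le> (1 + 1 / c) * (a - b)\<^sup>2 + c * b\<^sup>2"
proof -
  have "0 \<le> (c * b - (a - b))\<^sup>2 / c" "0 \<le> (c * b + (a - b))\<^sup>2 / c"
    using assms by simp_all
  moreover have "(c * b - (a - b))\<^sup>2 / c = c * b\<^sup>2 - 2 * b * (a - b) + (a - b)\<^sup>2 / c"
    "(c * b + (a - b))\<^sup>2 / c = c * b\<^sup>2 + 2 * b * (a - b) + (a - b)\<^sup>2 / c"
    using assms by (simp_all add: power2_eq_square field_simps)
  moreover have "a\<^sup>2 - b\<^sup>2 = (a - b)\<^sup>2 + 2 * b * (a - b)"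
    by (simp add: power2_eq_square algebra_simps)
  moreover have "0 \<le> (a - b)\<^sup>2" by simp
  moreover have "(1 + 1 / c) * (a - b)\<^sup>2 = (a - b)\<^sup>2 + (a - b)\<^sup>2 / c" by (simp add: algebra_simps)
  ultimately show ?thesis by linarith
qed

lemma L2_comparison:
  fixes f h :: "'a \<Rightarrow> real"
  assumes [measurable]: "f \<in> borel_measurable M" "h \<in> borel_measurable M"
    and int: "integrable M (\<lambda>x. (f x)\<^sup>2)" "integrable M (\<lambda>x. (h x)\<^sup>2)" and "0 < c"
  shows "integrable M (\<lambda>x. (f x - h x)\<^sup>2)"
    and "\<bar>(\<integral>x. (f x)\<^sup>2 \<partial>M) - (\<integral>x. (h x)\<^sup>2 \<partial>M)\<bar>
          \<le> (1 + 1 / c) * (\<integral>x. (f x - h x)\<^sup>2 \<partial>M) + c * (\<integral>x. (h x)\<^sup>2 \<partial>M)"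
proof -
  show d: "integrable M (\<lambda>x. (f x - h x)\<^sup>2)"
  proof (rule Bochner_Integration.integrable_bound)
    show "integrable M (\<lambda>x. 2 * (f x)\<^sup>2 + 2 * (h x)\<^sup>2)" using int by simp
    show "AE x in M. norm ((f x - h x)\<^sup>2) \<le> norm (2 * (f x)\<^sup>2 + 2 * (h x)\<^sup>2)"
    proof (rule AE_I2)
      fix x
      have "(f x - h x)\<^sup>2 \<le> 2 * (f x)\<^sup>2 + 2 * (h x)\<^sup>2"
        using square_diff_le[of "f x" "h x" 0] by simp
      then show "norm ((f x - h x)\<^sup>2) \<le> norm (2 * (f x)\<^sup>2 + 2 * (h x)\<^sup>2)"
        unfolding real_norm_def by (metis abs_ge_self abs_power2 order.trans)
    qed
  qed (intro borel_measurable_power borel_measurable_diff assms)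
  have "\<bar>(\<integral>x. (f x)\<^sup>2 \<partial>M) - (\<integral>x. (h x)\<^sup>2 \<partial>M)\<bar> = \<bar>\<integral>x. (f x)\<^sup>2 - (h x)\<^sup>2 \<partial>M\<bar>"
    by (simp only: Bochner_Integration.integral_diff[OF int])
  also have "\<dots> \<le> (\<integral>x. \<bar>(f x)\<^sup>2 - (h x)\<^sup>2\<bar> \<partial>M)"
    by (rule integral_abs_bound)
  also have "\<dots> \<le> (\<integral>x. (1 + 1 / c) * (f x - h x)\<^sup>2 + c * (h x)\<^sup>2 \<partial>M)"
    using int d abs_diff_squares_le[OF \<open>0 < c\<close>] by (intro integral_mono) auto
  also have "\<dots> = (1 + 1 / c) * (\<integral>x. (f x - h x)\<^sup>2 \<partial>M) + c * (\<integral>x. (h x)\<^sup>2 \<partial>M)"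
    using int d by (subst Bochner_Integration.integral_add) auto
  finally show "\<bar>(\<integral>x. (f x)\<^sup>2 \<partial>M) - (\<integral>x. (h x)\<^sup>2 \<partial>M)\<bar>
          \<le> (1 + 1 / c) * (\<integral>x. (f x - h x)\<^sup>2 \<partial>M) + c * (\<integral>x. (h x)\<^sup>2 \<partial>M)" .
qed

text \<open>The counterpart of \<open>L2_comparison\<close> for sums; the errors have the same shape
  and can be added later.\<close>

lemma dyadic_sq_sum_comparison:
  assumes "0 < c"
  shows "\<bar>dyadic_sq_sum g t m - dyadic_sq_sum f t m\<bar>
    \<le> (1 + 1 / c) * dyadic_sq_sum (\<lambda>x. g x - f x) t m + c * dyadic_sq_sum f t m"
proof -
  have incr: "dyadic_incr (\<lambda>x. g x - f x) t m k = dyadic_incr g t m k - dyadic_incr f t m k" for k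
    by (simp add: dyadic_incr_def)
  show ?thesis
    unfolding dyadic_sq_sum_eq incr sum_subtractf[symmetric] sum_distrib_left sum.distrib[symmetric]
    by (intro order.trans[OF sum_abs] sum_mono abs_diff_squares_le assms)
qed

lemma dyadic_sq_sum_diff_le:
  "dyadic_sq_sum (\<lambda>x. f x - h x) t m \<le>
    2 * dyadic_sq_sum (\<lambda>x. f x - g x) t m + 2 * dyadic_sq_sum (\<lambda>x. h x - g x) t m"
proof -
  have "(dyadic_incr (\<lambda>x. f x - h x) t m k)\<^sup>2 \<le>
    2 * (dyadic_incr (\<lambda>x. f x - g x) t m k)\<^sup>2 + 2 * (dyadic_incr (\<lambda>x. h x - g x) t m k)\<^sup>2" for k
    using square_diff_le[of "dyadic_incr f t m k" "dyadic_incr h t m k" "dyadic_incr g t m k"]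
    by (simp add: dyadic_incr_def algebra_simps)
  then show ?thesis
    unfolding dyadic_sq_sum_eq sum_distrib_left sum.distrib[symmetric] by (intro sum_mono)
qed

text \<open>The factor \<open>2 ^ m\<close> is harmless because \<open>m\<close> stays fixed where
  this is applied.\<close>

lemma dyadic_sq_sum_le_sup:
  assumes "\<And>k. k \<le> 2 ^ m \<Longrightarrow> \<bar>f (real k * t / 2 ^ m)\<bar> \<le> \<delta>"
  shows "dyadic_sq_sum f t m \<le> 2 ^ m * (2 * \<delta>)\<^sup>2"
proof -
  have "(dyadic_incr f t m k)\<^sup>2 \<le> (2 * \<delta>)\<^sup>2" if "k < 2 ^ m" for k
  proof -
    have "\<bar>dyadic_incr f t m k\<bar> \<le> 2 * \<delta>"
      unfolding dyadic_incr_def using assms[of k] assms[of "Suc k"] that by linarith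
    then show ?thesis by (metis abs_ge_zero power2_abs power_mono)
  qed
  then have "dyadic_sq_sum f t m \<le> (\<Sum>k<(2::nat) ^ m. (2 * \<delta>)\<^sup>2)"
    unfolding dyadic_sq_sum_eq by (intro sum_mono) auto
  then show ?thesis by simp
qed

section \<open>From bounds in probability to almost sure statements\<close>

text \<open>A Fatou lemma for events: the intersections increase to the union, and each is contained
  in some \<open>A m\<close>. Outside the union infinitely many \<open>A m\<close> fail.\<close>

lemma (in finite_measure) measure_liminf_le:
  assumes A: "\<And>m. A m \<in> sets M" "\<And>m. measure M (A m) \<le> b"
  shows "(\<Union>N. \<Inter>m\<in>{N::nat..}. A m) \<in> sets M" "measure M (\<Union>N. \<Inter>m\<in>{N..}. A m) \<le> b"
proof -
  have B: "(\<Inter>m\<in>{N..}. A m) \<in> sets M" for N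
    using A by (intro sets.countable_INT') auto
  then show "(\<Union>N. \<Inter>m\<in>{N::nat..}. A m) \<in> sets M" by auto
  have "(\<lambda>N. measure M (\<Inter>m\<in>{N..}. A m)) \<longlonglongrightarrow> measure M (\<Union>N. \<Inter>m\<in>{N..}. A m)"
    using B by (intro finite_Lim_measure_incseq) (auto simp: incseq_def)
  moreover have "measure M (\<Inter>m\<in>{N..}. A m) \<le> b" for N
    using A B by (intro order.trans[OF finite_measure_mono A(2)[of N]]) auto
  ultimately show "measure M (\<Union>N. \<Inter>m\<in>{N..}. A m) \<le> b"
    by (intro LIMSEQ_le_const2) auto
qed

text \<open>Up to null sets, the exceptional points lie in all the sets chosen for
  \<open>e = 1 / real (Suc n)\<close>, and the intersection of these sets is null.\<close>

lemma (in finite_measure) AE_if_AE_outside_small_sets: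
  assumes "\<And>e. 0 < e \<Longrightarrow> \<exists>A\<in>sets M. measure M A \<le> e \<and> (AE \<omega> in M. \<omega> \<notin> A \<longrightarrow> P \<omega>)"
  shows "AE \<omega> in M. P \<omega>"
proof -
  have "\<forall>n. \<exists>A\<in>sets M. measure M A \<le> 1 / real (Suc n) \<and> (AE \<omega> in M. \<omega> \<notin> A \<longrightarrow> P \<omega>)"
    using assms by simp
  then obtain A where A: "\<And>n. A n \<in> sets M" "\<And>n. measure M (A n) \<le> 1 / real (Suc n)"
    "\<And>n. AE \<omega> in M. \<omega> \<notin> A n \<longrightarrow> P \<omega>" by metis
  have I: "(\<Inter>n. A n) \<in> sets M" using A by auto
  have "measure M (\<Inter>n. A n) \<le> 0"
  proof (rule LIMSEQ_le_const)
    show "(\<lambda>n. 1 / real (Suc n)) \<longlonglongrightarrow> 0" using LIMSEQ_inverse_real_of_nat by (simp add: inverse_eq_divide)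
    show "\<exists>N. \<forall>n\<ge>N. measure M (\<Inter>n. A n) \<le> 1 / real (Suc n)"
      using A I by (intro exI allI impI order.trans[OF finite_measure_mono A(2)]) auto
  qed
  then have "measure M (\<Inter>n. A n) = 0" by (simp add: measure_le_0_iff)
  then have "(\<Inter>n. A n) \<in> null_sets M"
    using I by (simp add: null_sets_def emeasure_eq_measure)
  then have "AE \<omega> in M. \<omega> \<notin> (\<Inter>n. A n)" by (rule AE_not_in)
  moreover have "AE \<omega> in M. \<forall>n. \<omega> \<notin> A n \<longrightarrow> P \<omega>"
    using A(3) by (intro AE_all_countable[THEN iffD2] allI)
  ultimately show ?thesis by eventually_elim auto
qed

lemma LIMSEQ_le_frequently:
  fixes a b :: "nat \<Rightarrow> real"
  assumes "a \<longlonglongrightarrow> x" "b \<longlonglongrightarrow> y" "\<And>N. \<exists>m\<ge>N. a m \<le> b m"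
  shows "x \<le> y"
proof (rule ccontr)
  assume "\<not> x \<le> y"
  then have "0 < x - y" by simp
  with tendsto_diff[OF assms(1,2)] have "eventually (\<lambda>m. 0 < a m - b m) sequentially"
    by (rule order_tendstoD)
  then show False
    using assms(3) unfolding eventually_sequentially by (metis diff_gt_0_iff_gt linorder_not_le)
qed

text \<open>This identifies the limit in \<open>simple_integral_dyadic_sq_sum\<close> as an
  integral.\<close>

lemma simple_process_square_integral:
  assumes simple: "simple_integrand F n \<tau> \<xi>" and "0 \<le> t"
  shows "set_integrable lborel {0..t} (\<lambda>s. (simple_process n \<tau> \<xi> s \<omega>)\<^sup>2)"
    and "(LBINT s:{0..t}. (simple_process n \<tau> \<xi> s \<omega>)\<^sup>2) =
      (\<Sum>i<n. (\<xi> i \<omega>)\<^sup>2 * (min (\<tau> (Suc i)) t - min (\<tau> i) t))"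
proof -
  note \<tau>_less = simple_integrand_times(1)[OF simple] and \<tau>_le = simple_integrand_times(2)[OF simple]
    and \<tau>_nn = simple_integrand_times(3)[OF simple]
  have disj: "indicator {\<tau> i<..\<tau> (Suc i)} s * indicator {\<tau> j<..\<tau> (Suc j)} s = (0::real)"
    if "i < n" "j < n" "i \<noteq> j" for i j s
    using \<tau>_le[of "Suc i" j] \<tau>_le[of "Suc j" i] that by (cases "i < j") (auto split: split_indicator)
  have sq: "(simple_process n \<tau> \<xi> s \<omega>)\<^sup>2 = (\<Sum>i<n. (\<xi> i \<omega>)\<^sup>2 * indicator {\<tau> i<..\<tau> (Suc i)} s)" for s
  proof -
    have "(simple_process n \<tau> \<xi> s \<omega>)\<^sup>2 = (\<Sum>i<n. \<Sum>j<n. \<xi> i \<omega> * \<xi> j \<omega> *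
        (indicator {\<tau> i<..\<tau> (Suc i)} s * indicator {\<tau> j<..\<tau> (Suc j)} s))"
      unfolding simple_process_def power2_eq_square sum_product by (simp add: mult_ac)
    also have "\<dots> = (\<Sum>i<n. \<Sum>j<n. if j = i then (\<xi> i \<omega>)\<^sup>2 * indicator {\<tau> i<..\<tau> (Suc i)} s else 0)"
      using disj by (intro sum.cong refl) (auto simp: power2_eq_square split: split_indicator)
    finally show ?thesis by simp
  qed
  have cut: "indicator {0..t} s * (\<Sum>i<n. (\<xi> i \<omega>)\<^sup>2 * indicator {\<tau> i<..\<tau> (Suc i)} s) =
      (\<Sum>i<n. (\<xi> i \<omega>)\<^sup>2 * indicator {min (\<tau> i) t<..min (\<tau> (Suc i)) t} s)" for s
    unfolding sum_distrib_left
  proof (intro sum.cong refl)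
    fix i assume "i \<in> {..<n}"
    then have "0 \<le> \<tau> i" using \<tau>_nn[of i] by simp
    then have "{min (\<tau> i) t<..min (\<tau> (Suc i)) t} = {0..t} \<inter> {\<tau> i<..\<tau> (Suc i)}"
      by (auto simp: min_less_iff_disj)
    then show "indicator {0..t} s * ((\<xi> i \<omega>)\<^sup>2 * indicator {\<tau> i<..\<tau> (Suc i)} s)
      = (\<xi> i \<omega>)\<^sup>2 * indicator {min (\<tau> i) t<..min (\<tau> (Suc i)) t} s"
      by (simp add: indicator_inter_arith)
  qed
  have int: "integrable lborel (\<lambda>s. (\<xi> i \<omega>)\<^sup>2 * indicator {min (\<tau> i) t<..min (\<tau> (Suc i)) t} s :: real)" for i
    by (intro integrable_mult_right integrable_real_indicator) (simp, rule emeasure_bounded_finite, simp)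
  show "set_integrable lborel {0..t} (\<lambda>s. (simple_process n \<tau> \<xi> s \<omega>)\<^sup>2)"
    unfolding set_integrable_def sq real_scaleR_def cut
    by (intro Bochner_Integration.integrable_sum int)
  have "(LBINT s:{0..t}. (simple_process n \<tau> \<xi> s \<omega>)\<^sup>2) =
    (\<Sum>i<n. LBINT s. (\<xi> i \<omega>)\<^sup>2 * indicator {min (\<tau> i) t<..min (\<tau> (Suc i)) t} s)"
    unfolding set_lebesgue_integral_def sq real_scaleR_def cut
    by (intro Bochner_Integration.integral_sum int)
  also have "\<dots> = (\<Sum>i<n. (\<xi> i \<omega>)\<^sup>2 * (min (\<tau> (Suc i)) t - min (\<tau> i) t))"
  proof (intro sum.cong refl)
    fix i assume "i \<in> {..<n}"
    then have "min (\<tau> i) t \<le> min (\<tau> (Suc i)) t"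
      using \<tau>_less[of i] by auto
    then show "(LBINT s. (\<xi> i \<omega>)\<^sup>2 * indicator {min (\<tau> i) t<..min (\<tau> (Suc i)) t} s) =
      (\<xi> i \<omega>)\<^sup>2 * (min (\<tau> (Suc i)) t - min (\<tau> i) t)" by simp
  qed
  finally show "(LBINT s:{0..t}. (simple_process n \<tau> \<xi> s \<omega>)\<^sup>2) =
      (\<Sum>i<n. (\<xi> i \<omega>)\<^sup>2 * (min (\<tau> (Suc i)) t - min (\<tau> i) t))" .
qed

section \<open>Identification of the limit of the dyadic sums\<close>

context wiener_space
begin

lemma measurable_F_M: "(\<lambda>\<omega>. \<omega>) \<in> measurable M (F t)"
  using sets_F_subset[of t] by (intro measurableI) (auto dest: sets.sets_into_space simp: Int_absorb2)

text \<open>Progressive measurability up to \<open>t\<close> only concerns times in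
  \<open>[0,t]\<close>. Clamping the time extends the process to the whole line without changing it
  there, and the resulting joint measurability makes integrals over time measurable in
  \<open>\<omega>\<close>.\<close>

lemma progressively_measurable_clamped:
  assumes "progressively_measurable F H" "0 \<le> t"
  shows "(\<lambda>(s, \<omega>). H (max 0 (min t s)) \<omega>) \<in> borel_measurable (borel \<Otimes>\<^sub>M M)"
proof -
  have H: "(\<lambda>(s, \<omega>). H s \<omega>) \<in> borel_measurable (restrict_space borel {0..t} \<Otimes>\<^sub>M F t)"
    using assms by (simp add: progressively_measurable_def)
  have 1: "(\<lambda>p. max 0 (min t (fst p))) \<in> measurable (borel \<Otimes>\<^sub>M M) (restrict_space borel {0..t})"
    using \<open>0 \<le> t\<close> by (intro measurable_restrict_space2) auto
  have 2: "(\<lambda>p. snd p) \<in> measurable (borel \<Otimes>\<^sub>M M) (F t)"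
    using measurable_compose[OF measurable_snd measurable_F_M] .
  have "(\<lambda>p. (max 0 (min t (fst p)), snd p)) \<in> measurable (borel \<Otimes>\<^sub>M M) (restrict_space borel {0..t} \<Otimes>\<^sub>M F t)"
    using 1 2 by (rule measurable_Pair)
  from measurable_compose[OF this H] show ?thesis by (simp add: split_beta')
qed

lemma simple_integral_measurable:
  assumes "simple_integrand F n \<tau> \<xi>" "0 \<le> x"
  shows "simple_integral W n \<tau> \<xi> x \<in> borel_measurable M"
proof -
  note \<tau>_nn = simple_integrand_times(3)[OF assms(1)]
  have "\<xi> i \<in> borel_measurable M" if "i < n" for i
    using assms(1) that F_measurable_M[of "\<xi> i" "\<tau> i"] by (simp add: simple_integrand_def)
  then have "(\<lambda>\<omega>. \<Sum>i<n. \<xi> i \<omega> * (W (min (\<tau> (Suc i)) x) \<omega> - W (min (\<tau> i) x) \<omega>)) \<in> borel_measurable M"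
    using \<tau>_nn assms(2)
    by (intro borel_measurable_sum borel_measurable_times borel_measurable_diff W_measurable) auto
  then show ?thesis by (simp add: simple_integral_def[abs_def])
qed

lemma dyadic_sq_sum_measurable:
  assumes "\<And>x. 0 \<le> x \<Longrightarrow> Y x \<in> borel_measurable M" "0 \<le> t"
  shows "(\<lambda>\<omega>. dyadic_sq_sum (\<lambda>x. Y x \<omega>) t m) \<in> borel_measurable M"
  unfolding dyadic_sq_sum_eq dyadic_incr_def using assms
  by (intro borel_measurable_sum borel_measurable_power borel_measurable_diff assms) auto

text \<open>The process \<open>X\<close> may differ from \<open>I\<close> by a process with
  vanishing square sums, which for the equation is the drift. \<open>Q\<close> and the integral of
  \<open>(H s \<omega>)\<^sup>2\<close> are both compared with the square integral of one simple
  integrand: its dyadic sums link it to \<open>Q\<close>, its L2 distance from \<open>H\<close>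
  links it to the integral.\<close>

lemma ito_dyadic_sq_sum_limit:
  assumes ito: "has_ito_integral M F W H I" and t: "0 \<le> t"
    and X: "AE \<omega> in M. (\<lambda>m. dyadic_sq_sum (\<lambda>x. X x \<omega>) t m) \<longlonglongrightarrow> Q \<omega>"
    and D: "AE \<omega> in M. (\<lambda>m. dyadic_sq_sum (\<lambda>x. X x \<omega> - I x \<omega>) t m) \<longlonglongrightarrow> 0"
  shows "AE \<omega> in M. Q \<omega> = (LBINT s:{0..t}. (H s \<omega>)\<^sup>2)"
proof -
  obtain n \<tau> \<xi> where simple: "\<And>k. simple_integrand F (n k) (\<tau> k) (\<xi> k)" and
    L2_conv: "\<And>\<epsilon>. 0 < \<epsilon> \<Longrightarrow> (\<lambda>k. prob {\<omega> \<in> space M.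
      (\<integral>\<^sup>+ s\<in>{0..t}. ennreal ((simple_process (n k) (\<tau> k) (\<xi> k) s \<omega> - H s \<omega>)\<^sup>2) \<partial>lborel) > ennreal \<epsilon>}) \<longlonglongrightarrow> 0" and
    int_conv: "\<And>x \<epsilon>. 0 \<le> x \<Longrightarrow> 0 < \<epsilon> \<Longrightarrow> (\<lambda>k. prob {\<omega> \<in> space M.
      \<bar>simple_integral W (n k) (\<tau> k) (\<xi> k) x \<omega> - I x \<omega>\<bar> > \<epsilon>}) \<longlonglongrightarrow> 0"
    using ito t unfolding has_ito_integral_def by blast
  define G where "G = (\<lambda>k s \<omega>. simple_process (n k) (\<tau> k) (\<xi> k) s \<omega>)"
  define J where "J = (\<lambda>k x \<omega>. simple_integral W (n k) (\<tau> k) (\<xi> k) x \<omega>)"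
  define d where "d = (\<lambda>k \<omega>. \<integral>\<^sup>+ s\<in>{0..t}. ennreal ((G k s \<omega> - H s \<omega>)\<^sup>2) \<partial>lborel)"
  define Hc where "Hc = (\<lambda>s \<omega>. H (max 0 (min t s)) \<omega>)"
  have Hc_eq: "Hc s \<omega> = H s \<omega>" if "s \<in> {0..t}" for s \<omega>
    using that by (simp add: Hc_def)
  have Hc [measurable]: "(\<lambda>(s, \<omega>). Hc s \<omega>) \<in> borel_measurable (borel \<Otimes>\<^sub>M M)"
    unfolding Hc_def using ito t by (intro progressively_measurable_clamped) (auto simp: has_ito_integral_def)
  have \<xi>_meas: "\<xi> k i \<in> borel_measurable M" if "i < n k" for k i
    using simple[of k] that F_measurable_M by (auto simp: simple_integrand_def)
  have G_meas: "(\<lambda>p. G k (snd p) (fst p)) \<in> borel_measurable (M \<Otimes>\<^sub>M borel)" for k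
    unfolding G_def simple_process_def
  proof (intro borel_measurable_sum borel_measurable_times)
    fix i assume "i \<in> {..<n k}"
    then show "(\<lambda>p. \<xi> k i (fst p)) \<in> borel_measurable (M \<Otimes>\<^sub>M borel)"
      using measurable_compose[OF measurable_fst \<xi>_meas] by simp
  qed measurable
  have Hc': "(\<lambda>p. Hc (snd p) (fst p)) \<in> borel_measurable (M \<Otimes>\<^sub>M borel)"
    using measurable_compose[OF measurable_pair_swap' Hc] by (simp add: split_beta')
  have d_eq: "d k \<omega> = (\<integral>\<^sup>+ s. ennreal ((G k s \<omega> - Hc s \<omega>)\<^sup>2) * indicator {0..t} s \<partial>lborel)" for k \<omega>
    unfolding d_def by (intro nn_integral_cong) (auto simp: Hc_eq split: split_indicator)
  have d_meas [measurable]: "d k \<in> borel_measurable M" for k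
  proof -
    have "(\<lambda>(\<omega>, s). ennreal ((G k s \<omega> - Hc s \<omega>)\<^sup>2) * indicator {0..t} s) \<in> borel_measurable (M \<Otimes>\<^sub>M lborel)"
      using G_meas[of k] Hc' unfolding split_beta' by measurable
    from lborel.borel_measurable_nn_integral[OF this] show ?thesis
      unfolding d_eq by simp
  qed
  have J_meas: "J k x \<in> borel_measurable M" if "0 \<le> x" for k x
    unfolding J_def using simple_integral_measurable[OF simple that] .
  have I_meas: "I x \<in> borel_measurable M" if "0 \<le> x" for x
    using ito that by (simp add: has_ito_integral_def continuous_process_def)
  have JI_meas [measurable]: "(\<lambda>\<omega>. dyadic_sq_sum (\<lambda>x. J k x \<omega> - I x \<omega>) t m) \<in> borel_measurable M" for k m
    by (intro dyadic_sq_sum_measurable borel_measurable_diff J_meas I_meas t)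
  have JJ_meas [measurable]: "(\<lambda>\<omega>. dyadic_sq_sum (\<lambda>x. J k x \<omega> - J l x \<omega>) t m) \<in> borel_measurable M" for k l m
    by (intro dyadic_sq_sum_measurable borel_measurable_diff J_meas t)
  define p where "p = (\<lambda>k \<eta>. prob {\<omega> \<in> space M. d k \<omega> > ennreal \<eta>})"
  have p_conv: "(\<lambda>k. p k \<eta>) \<longlonglongrightarrow> 0" if "0 < \<eta>" for \<eta>
    using L2_conv[OF that] by (simp add: p_def d_def G_def)

  \<comment> \<open>With \<open>m\<close> fixed, a union bound over the \<open>2 ^ m + 1\<close>
    dyadic points suffices; \<open>\<delta>\<close> is chosen such that deviations of at most
    \<open>\<delta>\<close> there keep the square sum at most \<open>\<epsilon>\<close>.\<close>
  have mesh_conv: "(\<lambda>l. prob {\<omega> \<in> space M. dyadic_sq_sum (\<lambda>x. J l x \<omega> - I x \<omega>) t m > \<epsilon>}) \<longlonglongrightarrow> 0"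
    if "0 < \<epsilon>" for m \<epsilon>
  proof -
    let ?x = "\<lambda>j. real j * t / 2 ^ m"
    define \<delta> where "\<delta> = sqrt (\<epsilon> / 2 ^ m) / 2"
    have \<delta>: "0 < \<delta>" "2 ^ m * (2 * \<delta>)\<^sup>2 = \<epsilon>"
      using that by (simp_all add: \<delta>_def)
    let ?B = "\<lambda>l j. {\<omega> \<in> space M. \<bar>J l (?x j) \<omega> - I (?x j) \<omega>\<bar> > \<delta>}"
    have B: "?B l j \<in> events" for l j
    proof -
      have [measurable]: "J l (?x j) \<in> borel_measurable M" "I (?x j) \<in> borel_measurable M"
        using t by (auto intro!: J_meas I_meas)
      show ?thesis by measurable
    qed
    have "prob {\<omega> \<in> space M. dyadic_sq_sum (\<lambda>x. J l x \<omega> - I x \<omega>) t m > \<epsilon>} \<le> (\<Sum>j\<in>{..2 ^ m}. prob (?B l j))" for l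
    proof -
      have "{\<omega> \<in> space M. dyadic_sq_sum (\<lambda>x. J l x \<omega> - I x \<omega>) t m > \<epsilon>} \<subseteq> (\<Union>j\<in>{..2 ^ m}. ?B l j)"
      proof (rule subsetI, rule ccontr)
        fix \<omega> assume \<omega>: "\<omega> \<in> {\<omega> \<in> space M. dyadic_sq_sum (\<lambda>x. J l x \<omega> - I x \<omega>) t m > \<epsilon>}"
          "\<omega> \<notin> (\<Union>j\<in>{..2 ^ m}. ?B l j)"
        then have "\<bar>J l (?x j) \<omega> - I (?x j) \<omega>\<bar> \<le> \<delta>" if "j \<le> 2 ^ m" for j
          using that by force
        from dyadic_sq_sum_le_sup[of m "\<lambda>x. J l x \<omega> - I x \<omega>", OF this] \<omega>(1) \<delta> show False by simp
      qed
      then have "prob {\<omega> \<in> space M. dyadic_sq_sum (\<lambda>x. J l x \<omega> - I x \<omega>) t m > \<epsilon>} \<le> prob (\<Union>j\<in>{..2 ^ m}. ?B l j)"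
        using B by (intro finite_measure_mono) auto
      also have "\<dots> \<le> (\<Sum>j\<in>{..2 ^ m}. prob (?B l j))"
        using B by (intro measure_UNION_le) auto
      finally show ?thesis .
    qed
    then have le: "eventually (\<lambda>l. prob {\<omega> \<in> space M. dyadic_sq_sum (\<lambda>x. J l x \<omega> - I x \<omega>) t m > \<epsilon>}
        \<le> (\<Sum>j\<in>{..2 ^ m}. prob (?B l j))) sequentially" by simp
    have "(\<lambda>l. \<Sum>j\<in>{..2 ^ m}. prob (?B l j)) \<longlonglongrightarrow> (\<Sum>j\<in>{..(2::nat) ^ m}. 0)"
      unfolding J_def using \<delta> t by (intro tendsto_sum int_conv) auto
    then have "(\<lambda>l. \<Sum>j\<in>{..2 ^ m}. prob (?B l j)) \<longlonglongrightarrow> 0" by simp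
    then show ?thesis by (rule tendsto_sandwich[OF _ le tendsto_const, rotated]) auto
  qed

  \<comment> \<open>\<open>J k - I\<close> is split through \<open>J l\<close>, and \<open>l\<close>
    tends to infinity at the end. Splitting a square costs a factor 2 on both parts: hence the
    thresholds \<open>\<epsilon> / 4\<close> for the two square sums and \<open>\<eta> / 4\<close>
    for the distances \<open>d k\<close> and \<open>d l\<close>, and the quotient
    \<open>\<eta> / (\<epsilon> / 4) = 4 * \<eta> / \<epsilon>\<close>.\<close>
  have bound: "prob {\<omega> \<in> space M. dyadic_sq_sum (\<lambda>x. J k x \<omega> - I x \<omega>) t m > \<epsilon>}
      \<le> p k (\<eta> / 4) + 4 * \<eta> / \<epsilon>" if "0 < \<epsilon>" "0 < \<eta>" for k m \<epsilon> \<eta>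
  proof (rule LIMSEQ_le_const)
    let ?S = "\<lambda>l. {\<omega> \<in> space M. dyadic_sq_sum (\<lambda>x. J l x \<omega> - I x \<omega>) t m > \<epsilon> / 4}"
    let ?C = "\<lambda>l. {\<omega> \<in> space M. dyadic_sq_sum (\<lambda>x. J k x \<omega> - J l x \<omega>) t m > \<epsilon> / 4}"
    have "(\<lambda>l. prob (?S l) + (p k (\<eta> / 4) + p l (\<eta> / 4) + \<eta> / (\<epsilon> / 4))) \<longlonglongrightarrow>
        0 + (p k (\<eta> / 4) + 0 + \<eta> / (\<epsilon> / 4))"
      using that by (intro tendsto_add tendsto_const mesh_conv p_conv) auto
    then show "(\<lambda>l. prob (?S l) + (p k (\<eta> / 4) + p l (\<eta> / 4) + \<eta> / (\<epsilon> / 4))) \<longlonglongrightarrow> p k (\<eta> / 4) + 4 * \<eta> / \<epsilon>"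
      by (simp add: mult.commute)
    have "prob {\<omega> \<in> space M. dyadic_sq_sum (\<lambda>x. J k x \<omega> - I x \<omega>) t m > \<epsilon>} \<le>
      prob (?S l) + (p k (\<eta> / 4) + p l (\<eta> / 4) + \<eta> / (\<epsilon> / 4))" for l
    proof -
      have "{\<omega> \<in> space M. dyadic_sq_sum (\<lambda>x. J k x \<omega> - I x \<omega>) t m > \<epsilon>} \<subseteq> ?S l \<union> ?C l"
      proof
        fix \<omega> assume \<omega>: "\<omega> \<in> {\<omega> \<in> space M. dyadic_sq_sum (\<lambda>x. J k x \<omega> - I x \<omega>) t m > \<epsilon>}"
        have "dyadic_sq_sum (\<lambda>x. J k x \<omega> - I x \<omega>) t m \<le>
          2 * dyadic_sq_sum (\<lambda>x. J k x \<omega> - J l x \<omega>) t m + 2 * dyadic_sq_sum (\<lambda>x. I x \<omega> - J l x \<omega>) t m"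
          by (rule dyadic_sq_sum_diff_le)
        moreover have "dyadic_sq_sum (\<lambda>x. I x \<omega> - J l x \<omega>) t m = dyadic_sq_sum (\<lambda>x. J l x \<omega> - I x \<omega>) t m"
          unfolding dyadic_sq_sum_eq dyadic_incr_def
          by (intro sum.cong refl) (simp add: power2_eq_square algebra_simps)
        ultimately show "\<omega> \<in> ?S l \<union> ?C l" using \<omega> by auto
      qed
      then have "prob {\<omega> \<in> space M. dyadic_sq_sum (\<lambda>x. J k x \<omega> - I x \<omega>) t m > \<epsilon>} \<le> prob (?S l \<union> ?C l)"
        by (intro finite_measure_mono) measurable
      also have "\<dots> \<le> prob (?S l) + prob (?C l)"
        by (intro measure_Un_le) measurable
      also have "prob (?C l) \<le> prob ({\<omega> \<in> space M. d k \<omega> > ennreal (\<eta> / 4)} \<union> {\<omega> \<in> space M. d l \<omega> > ennreal (\<eta> / 4)})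
          + \<eta> / (\<epsilon> / 4)"
        unfolding J_def
      proof (rule simple_integrals_dyadic_lenglart[OF simple simple t])
        fix \<omega> assume \<omega>: "\<omega> \<in> space M - ({\<omega> \<in> space M. d k \<omega> > ennreal (\<eta> / 4)} \<union> {\<omega> \<in> space M. d l \<omega> > ennreal (\<eta> / 4)})"
        then have [measurable]: "\<omega> \<in> space M" by simp
        have [measurable]: "(\<lambda>s. G j s \<omega>) \<in> borel_measurable borel" "(\<lambda>s. Hc s \<omega>) \<in> borel_measurable borel" for j
          using measurable_Pair2[OF G_meas[of j] \<open>\<omega> \<in> space M\<close>] measurable_Pair2[OF Hc' \<open>\<omega> \<in> space M\<close>] by simp_all
        have "(\<integral>\<^sup>+ s\<in>{0..t}. ennreal ((G k s \<omega> - G l s \<omega>)\<^sup>2) \<partial>lborel) \<le>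
          (\<integral>\<^sup>+ s. 2 * (ennreal ((G k s \<omega> - Hc s \<omega>)\<^sup>2) * indicator {0..t} s) +
             2 * (ennreal ((G l s \<omega> - Hc s \<omega>)\<^sup>2) * indicator {0..t} s) \<partial>lborel)"
        proof (rule nn_integral_mono)
          fix s
          have "ennreal ((G k s \<omega> - G l s \<omega>)\<^sup>2) \<le> ennreal (2 * (G k s \<omega> - Hc s \<omega>)\<^sup>2 + 2 * (G l s \<omega> - Hc s \<omega>)\<^sup>2)"
            by (intro ennreal_leI square_diff_le)
          also have "\<dots> = 2 * ennreal ((G k s \<omega> - Hc s \<omega>)\<^sup>2) + 2 * ennreal ((G l s \<omega> - Hc s \<omega>)\<^sup>2)"
            by (simp add: ennreal_plus ennreal_mult)
          finally show "ennreal ((G k s \<omega> - G l s \<omega>)\<^sup>2) * indicator {0..t} s \<le>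
             2 * (ennreal ((G k s \<omega> - Hc s \<omega>)\<^sup>2) * indicator {0..t} s) +
             2 * (ennreal ((G l s \<omega> - Hc s \<omega>)\<^sup>2) * indicator {0..t} s)"
            by (auto split: split_indicator)
        qed
        also have "\<dots> = 2 * d k \<omega> + 2 * d l \<omega>"
          unfolding d_eq by (subst nn_integral_add; (subst nn_integral_cmult)?; (subst nn_integral_cmult)?) measurable
        also have "\<dots> \<le> 2 * ennreal (\<eta> / 4) + 2 * ennreal (\<eta> / 4)"
          using \<omega> by (intro add_mono mult_left_mono) auto
        also have "\<dots> = ennreal \<eta>"
          using \<open>0 < \<eta>\<close> by (simp add: ennreal_mult[symmetric] ennreal_plus[symmetric] del: ennreal_plus flip: ennreal_numeral)
        finally show "(\<integral>\<^sup>+ s\<in>{0..t}. ennreal ((simple_process (n k) (\<tau> k) (\<xi> k) s \<omega> -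
            simple_process (n l) (\<tau> l) (\<xi> l) s \<omega>)\<^sup>2) \<partial>lborel) \<le> ennreal \<eta>"
          by (simp add: G_def)
      qed (use that in \<open>auto\<close>)
      also have "prob ({\<omega> \<in> space M. d k \<omega> > ennreal (\<eta> / 4)} \<union> {\<omega> \<in> space M. d l \<omega> > ennreal (\<eta> / 4)})
          \<le> p k (\<eta> / 4) + p l (\<eta> / 4)"
        unfolding p_def by (intro measure_Un_le) measurable
      finally show ?thesis by simp
    qed
    then show "\<exists>N. \<forall>l\<ge>N. prob {\<omega> \<in> space M. dyadic_sq_sum (\<lambda>x. J k x \<omega> - I x \<omega>) t m > \<epsilon>} \<le>
      prob (?S l) + (p k (\<eta> / 4) + p l (\<eta> / 4) + \<eta> / (\<epsilon> / 4))" by blast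
  qed

  define V where "V = (\<lambda>\<omega>. LBINT s:{0..t}. (H s \<omega>)\<^sup>2)"
  define Vs where "Vs = (\<lambda>k \<omega>. \<Sum>i<n k. (\<xi> k i \<omega>)\<^sup>2 * (min (\<tau> k (Suc i)) t - min (\<tau> k i) t))"
  have Vs_V: "\<bar>Vs k \<omega> - V \<omega>\<bar> \<le> (1 + 1 / c) * \<epsilon> + c * V \<omega>"
    if "0 < c" "0 < \<epsilon>" "d k \<omega> \<le> ennreal \<epsilon>" and [measurable]: "\<omega> \<in> space M"
      and H_int: "set_integrable lborel {0..t} (\<lambda>s. (H s \<omega>)\<^sup>2)" for k c \<epsilon> \<omega>
  proof -
    have [measurable]: "(\<lambda>s. G k s \<omega>) \<in> borel_measurable borel" "(\<lambda>s. Hc s \<omega>) \<in> borel_measurable borel"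
      using measurable_Pair2[OF G_meas[of k] \<open>\<omega> \<in> space M\<close>] measurable_Pair2[OF Hc' \<open>\<omega> \<in> space M\<close>] by simp_all
    \<comment> \<open>The indicators turn integrals over \<open>[0,t]\<close> into integrals over
      the line and allow \<open>H\<close> to be replaced by its measurable extension
      \<open>Hc\<close>.\<close>
    let ?f = "\<lambda>s. indicator {0..t} s * G k s \<omega>" and ?h = "\<lambda>s. indicator {0..t} s * Hc s \<omega>"
    have f2: "(?f s)\<^sup>2 = indicator {0..t} s *\<^sub>R (G k s \<omega>)\<^sup>2" for s by (auto split: split_indicator)
    have h2: "(?h s)\<^sup>2 = indicator {0..t} s *\<^sub>R (H s \<omega>)\<^sup>2" for s
      by (auto simp: Hc_eq split: split_indicator)
    have "set_integrable lborel {0..t} (\<lambda>s. (G k s \<omega>)\<^sup>2)"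
      unfolding G_def using simple t by (rule simple_process_square_integral(1))
    then have fi: "integrable lborel (\<lambda>s. (?f s)\<^sup>2)"
      unfolding f2 set_integrable_def .
    have "(LBINT s:{0..t}. (G k s \<omega>)\<^sup>2) = Vs k \<omega>"
      unfolding G_def Vs_def using simple t by (rule simple_process_square_integral(2))
    then have fV: "(LBINT s. (?f s)\<^sup>2) = Vs k \<omega>"
      unfolding f2 set_lebesgue_integral_def .
    have hi: "integrable lborel (\<lambda>s. (?h s)\<^sup>2)"
      using H_int unfolding h2 set_integrable_def .
    have hV: "(LBINT s. (?h s)\<^sup>2) = V \<omega>"
      unfolding h2 V_def set_lebesgue_integral_def ..
    have fm: "?f \<in> borel_measurable lborel" and hm: "?h \<in> borel_measurable lborel" by measurable
    note cmp = L2_comparison[OF fm hm fi hi \<open>0 < c\<close>]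
    have "ennreal (LBINT s. (?f s - ?h s)\<^sup>2) = (\<integral>\<^sup>+ s. ennreal ((?f s - ?h s)\<^sup>2) \<partial>lborel)"
      using cmp(1) by (intro nn_integral_eq_integral[symmetric]) auto
    also have "\<dots> = d k \<omega>"
      unfolding d_eq by (intro nn_integral_cong) (auto split: split_indicator)
    also have "\<dots> \<le> ennreal \<epsilon>" by fact
    finally have "(LBINT s. (?f s - ?h s)\<^sup>2) \<le> \<epsilon>"
      using \<open>0 < \<epsilon>\<close> by (subst (asm) ennreal_le_iff) simp_all
    then have "(1 + 1 / c) * (LBINT s. (?f s - ?h s)\<^sup>2) \<le> (1 + 1 / c) * \<epsilon>"
      using \<open>0 < c\<close> by (intro mult_left_mono) auto
    then show ?thesis using cmp(2) unfolding fV hV by linarith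
  qed

  \<comment> \<open>Of \<open>3 * \<epsilon>\<close>, two parts come from the dyadic sums, where
    \<open>J k - X\<close> is split through \<open>I\<close>, and one comes from the
    integrals.\<close>
  have main: "AE \<omega> in M. \<bar>Q \<omega> - V \<omega>\<bar> \<le> (1 + 1 / c) * (3 * \<epsilon>) + c * (Q \<omega> + V \<omega>)"
    if "0 < c" "0 < \<epsilon>" for c \<epsilon> :: real
  proof (rule AE_if_AE_outside_small_sets)
    fix e :: real assume "0 < e"
    \<comment> \<open>With this value the two terms of \<open>bound\<close> are at most
      \<open>e / 4\<close> each, so the bad event for the meshes has probability at most
      \<open>e / 2\<close>, and less than \<open>e / 4\<close> is spent on the event that
      \<open>d k\<close> exceeds \<open>\<epsilon>\<close>.\<close>
    define \<eta> where "\<eta> = e * \<epsilon> / 16"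
    have \<eta>: "0 < \<eta>" "4 * \<eta> / \<epsilon> = e / 4" using \<open>0 < e\<close> \<open>0 < \<epsilon>\<close> by (auto simp: \<eta>_def)
    have "eventually (\<lambda>k. p k (\<eta> / 4) < e / 4) sequentially" "eventually (\<lambda>k. p k \<epsilon> < e / 4) sequentially"
      using \<eta>(1) \<open>0 < e\<close> \<open>0 < \<epsilon>\<close> by (intro order_tendstoD(2)[OF p_conv]; simp)+
    then have "eventually (\<lambda>k. p k (\<eta> / 4) < e / 4 \<and> p k \<epsilon> < e / 4) sequentially"
      by eventually_elim simp
    then obtain k where k: "p k (\<eta> / 4) < e / 4" "p k \<epsilon> < e / 4"
      by (auto simp: eventually_sequentially)
    let ?A = "\<lambda>m. {\<omega> \<in> space M. dyadic_sq_sum (\<lambda>x. J k x \<omega> - I x \<omega>) t m > \<epsilon>}"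
    let ?B = "\<Union>N. \<Inter>m\<in>{N::nat..}. ?A m" and ?E = "{\<omega> \<in> space M. d k \<omega> > ennreal \<epsilon>}"
    have A: "?A m \<in> events" "prob (?A m) \<le> e / 2" for m
      using bound[OF \<open>0 < \<epsilon>\<close> \<eta>(1), of k m] k(1) \<eta>(2) by (measurable, linarith)
    note B = measure_liminf_le[of ?A, OF A]
    have "?B \<union> ?E \<in> events" using B(1) by (intro sets.Un) auto
    moreover have "prob (?B \<union> ?E) \<le> e"
    proof -
      have "prob (?B \<union> ?E) \<le> prob ?B + prob ?E" using B(1) by (intro measure_Un_le) auto
      also have "prob ?E = p k \<epsilon>" by (simp add: p_def)
      finally show ?thesis using B(2) k(2) \<open>0 < e\<close> by linarith
    qed
    moreover have "AE \<omega> in M. \<omega> \<notin> ?B \<union> ?E \<longrightarrow> \<bar>Q \<omega> - V \<omega>\<bar> \<le> (1 + 1 / c) * (3 * \<epsilon>) + c * (Q \<omega> + V \<omega>)"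
    proof -
      have "AE \<omega> in M. (\<lambda>m. dyadic_sq_sum (\<lambda>x. J k x \<omega>) t m) \<longlonglongrightarrow> Vs k \<omega>"
        unfolding J_def Vs_def by (rule simple_integral_dyadic_sq_sum[OF simple t])
      moreover have "AE \<omega> in M. set_integrable lborel {0..t} (\<lambda>s. (H s \<omega>)\<^sup>2)"
        using ito t by (simp add: has_ito_integral_def)
      ultimately show ?thesis using X D AE_space
      proof eventually_elim
        case (elim \<omega>)
        show ?case
        proof
          assume \<omega>: "\<omega> \<notin> ?B \<union> ?E"
          let ?S = "\<lambda>f m. dyadic_sq_sum f t m"
          have "\<bar>Vs k \<omega> - Q \<omega>\<bar> \<le> (1 + 1 / c) * (2 * 0 + 2 * \<epsilon>) + c * Q \<omega>"
          proof (rule LIMSEQ_le_frequently)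
            show "(\<lambda>m. \<bar>?S (\<lambda>x. J k x \<omega>) m - ?S (\<lambda>x. X x \<omega>) m\<bar>) \<longlonglongrightarrow> \<bar>Vs k \<omega> - Q \<omega>\<bar>"
              using elim by (intro tendsto_rabs tendsto_diff)
            show "(\<lambda>m. (1 + 1 / c) * (2 * ?S (\<lambda>x. X x \<omega> - I x \<omega>) m + 2 * \<epsilon>) + c * ?S (\<lambda>x. X x \<omega>) m)
              \<longlonglongrightarrow> (1 + 1 / c) * (2 * 0 + 2 * \<epsilon>) + c * Q \<omega>"
              using elim by (intro tendsto_add tendsto_mult tendsto_const)
            fix N
            have "\<exists>m\<ge>N. \<omega> \<notin> ?A m" using \<omega> by auto
            then obtain m where "N \<le> m" and m: "?S (\<lambda>x. J k x \<omega> - I x \<omega>) m \<le> \<epsilon>"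
              using elim by force
            have "?S (\<lambda>x. J k x \<omega> - X x \<omega>) m \<le> 2 * ?S (\<lambda>x. J k x \<omega> - I x \<omega>) m + 2 * ?S (\<lambda>x. X x \<omega> - I x \<omega>) m"
              by (rule dyadic_sq_sum_diff_le)
            also have "\<dots> \<le> 2 * ?S (\<lambda>x. X x \<omega> - I x \<omega>) m + 2 * \<epsilon>" using m by simp
            finally have "(1 + 1 / c) * ?S (\<lambda>x. J k x \<omega> - X x \<omega>) m \<le> (1 + 1 / c) * (2 * ?S (\<lambda>x. X x \<omega> - I x \<omega>) m + 2 * \<epsilon>)"
              using \<open>0 < c\<close> by (intro mult_left_mono) auto
            with dyadic_sq_sum_comparison[OF \<open>0 < c\<close>, of "\<lambda>x. J k x \<omega>" t m "\<lambda>x. X x \<omega>"] \<open>N \<le> m\<close>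
            show "\<exists>m\<ge>N. \<bar>?S (\<lambda>x. J k x \<omega>) m - ?S (\<lambda>x. X x \<omega>) m\<bar>
              \<le> (1 + 1 / c) * (2 * ?S (\<lambda>x. X x \<omega> - I x \<omega>) m + 2 * \<epsilon>) + c * ?S (\<lambda>x. X x \<omega>) m"
              by (intro exI[of _ m]) linarith
          qed
          moreover have "\<bar>Vs k \<omega> - V \<omega>\<bar> \<le> (1 + 1 / c) * \<epsilon> + c * V \<omega>"
            using \<omega> elim by (intro Vs_V \<open>0 < c\<close> \<open>0 < \<epsilon>\<close>) auto
          moreover have "(1 + 1 / c) * (3 * \<epsilon>) + c * (Q \<omega> + V \<omega>) =
            ((1 + 1 / c) * (2 * 0 + 2 * \<epsilon>) + c * Q \<omega>) + ((1 + 1 / c) * \<epsilon> + c * V \<omega>)"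
            by (simp add: algebra_simps)
          ultimately show "\<bar>Q \<omega> - V \<omega>\<bar> \<le> (1 + 1 / c) * (3 * \<epsilon>) + c * (Q \<omega> + V \<omega>)" by linarith
        qed
      qed
    qed
    ultimately show "\<exists>A\<in>events. prob A \<le> e \<and>
        (AE \<omega> in M. \<omega> \<notin> A \<longrightarrow> \<bar>Q \<omega> - V \<omega>\<bar> \<le> (1 + 1 / c) * (3 * \<epsilon>) + c * (Q \<omega> + V \<omega>))" by blast
  qed

  \<comment> \<open>Taking \<open>\<epsilon> = c\<^sup>2\<close> in \<open>main\<close> compensates
    the factor \<open>1 / c\<close>: the error becomes
    \<open>3 * c\<^sup>2 + 3 * c + c * (Q \<omega> + V \<omega>)\<close>. A sequence of weights
    keeps the exceptional sets countable in number.\<close>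
  define c where "c = (\<lambda>N. 1 / real (Suc N))"
  have c_pos: "0 < c N" for N by (simp add: c_def)
  have "AE \<omega> in M. \<forall>N. \<bar>Q \<omega> - V \<omega>\<bar> \<le> (1 + 1 / c N) * (3 * (c N)\<^sup>2) + c N * (Q \<omega> + V \<omega>)"
    by (intro AE_all_countable[THEN iffD2] allI main zero_less_power c_pos)
  then show ?thesis
  proof eventually_elim
    case (elim \<omega>)
    have c0: "c \<longlonglongrightarrow> 0"
      unfolding c_def using LIMSEQ_inverse_real_of_nat by (simp add: inverse_eq_divide)
    have "(\<lambda>N. 3 * (c N)\<^sup>2 + 3 * c N + c N * (Q \<omega> + V \<omega>)) \<longlonglongrightarrow> 3 * 0\<^sup>2 + 3 * 0 + 0 * (Q \<omega> + V \<omega>)"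
      by (intro tendsto_add tendsto_mult tendsto_power tendsto_const c0)
    moreover have "(1 + 1 / c N) * (3 * (c N)\<^sup>2) = 3 * (c N)\<^sup>2 + 3 * c N" for N
      using c_pos[of N] by (simp add: power2_eq_square field_simps)
    ultimately have "\<bar>Q \<omega> - V \<omega>\<bar> \<le> 3 * 0\<^sup>2 + 3 * 0 + 0 * (Q \<omega> + V \<omega>)"
      using elim by (intro LIMSEQ_le_const) auto
    then show ?case by (simp add: V_def)
  qed
qed

end

section \<open>Solutions of stochastic differential equations\<close>

lemma LBINT_eq_integral_continuous:
  fixes g :: "real \<Rightarrow> real"
  assumes "continuous_on {a..b} g"
  shows "(LBINT s:{a..b}. g s) = integral {a..b} g"
  using borel_integrable_atLeastAtMost'[OF assms] by (rule set_borel_integral_eq_integral)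

text \<open>The integrand is bounded on the compact interval \<open>[0,t]\<close>, so
  \<open>f\<close> is Lipschitz there.\<close>

lemma primitive_dyadic_sq_sum:
  fixes g :: "real \<Rightarrow> real"
  assumes g: "continuous_on {0..} g" and "0 \<le> t"
    and f: "\<And>x. 0 \<le> x \<Longrightarrow> f x = c + (LBINT s:{0..x}. g s)"
  shows "(\<lambda>m. dyadic_sq_sum f t m) \<longlonglongrightarrow> 0"
proof -
  have g': "continuous_on {x..y} g" if "0 \<le> x" for x y
    using continuous_on_subset[OF g] that by auto
  have "compact (g ` {0..t})"
    using g'[of 0 t] by (intro compact_continuous_image) auto
  then obtain K where K: "\<And>s. s \<in> {0..t} \<Longrightarrow> \<bar>g s\<bar> \<le> K"
    using compact_imp_bounded[THEN bounded_iff[THEN iffD1]] by fastforce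
  have "\<bar>f y - f x\<bar> \<le> K * (y - x)" if "0 \<le> x" "x \<le> y" "y \<le> t" for x y
  proof -
    have "integral {0..x} g + integral {x..y} g = integral {0..y} g"
      using that g' by (intro Henstock_Kurzweil_Integration.integral_combine integrable_continuous_real) auto
    then have "f y - f x = integral {x..y} g"
      using that g' by (simp add: f LBINT_eq_integral_continuous)
    also have "\<bar>\<dots>\<bar> \<le> K * (y - x)"
      using integral_bound[of x y g K] that g' K by auto
    finally show ?thesis .
  qed
  then have le: "dyadic_sq_sum f t m \<le> (K * t)\<^sup>2 / 2 ^ m" for m
    using \<open>0 \<le> t\<close> by (intro dyadic_sq_sum_lipschitz) auto
  have lim: "(\<lambda>m. (K * t)\<^sup>2 / 2 ^ m) \<longlonglongrightarrow> 0"
    by (intro LIMSEQ_divide_realpow_zero) simp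
  show ?thesis
    by (rule tendsto_sandwich[OF _ _ tendsto_const lim]) (auto simp: dyadic_sq_sum_nonneg le)
qed

lemma primitive_has_derivative:
  fixes g :: "real \<Rightarrow> real"
  assumes g: "continuous_on {0..} g" and "0 \<le> t"
  shows "((\<lambda>x. LBINT s:{0..x}. g s) has_real_derivative g t) (at t within {0..})"
proof -
  have g': "continuous_on {0..y} g" for y
    using continuous_on_subset[OF g] by auto
  \<comment> \<open>The interval is extended to \<open>t + 1\<close> so that \<open>t\<close> is not
    its right end; near \<open>t\<close> it then agrees with \<open>{0..}\<close>, and only at
    \<open>t = 0\<close> is the derivative one-sided.\<close>
  have "((\<lambda>x. integral {0..x} g) has_real_derivative g t) (at t within {0..t + 1})"
    using g' \<open>0 \<le> t\<close> by (intro integral_has_real_derivative) auto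
  moreover have "at t within {0..t + 1} = at t within {0..}"
    by (rule at_within_nhd[of _ "{..<t + 1}"]) auto
  ultimately show ?thesis by (simp add: LBINT_eq_integral_continuous[OF g'])
qed

lemma primitive_pos:
  fixes g :: "real \<Rightarrow> real"
  assumes g: "continuous_on {0..t} g" "\<And>s. s \<in> {0..t} \<Longrightarrow> 0 < g s" and "0 < t"
  shows "0 < (LBINT s:{0..t}. g s)"
proof -
  have "0 \<le> integral {0..t} g"
    using g by (intro Henstock_Kurzweil_Integration.integral_nonneg integrable_continuous_real) (auto simp: less_imp_le)
  moreover have "integral {0..t} g \<noteq> 0"
    using integral_eq_0_iff[of 0 t g] g \<open>0 < t\<close> by (force simp: less_imp_le)
  ultimately show ?thesis by (simp add: LBINT_eq_integral_continuous[OF g(1)])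
qed

lemma continuous_eq_if_eq_on_rats:
  fixes f h :: "real \<Rightarrow> real"
  assumes "continuous_on {0..} f" "continuous_on {0..} h"
    and eq: "\<And>q. q \<in> \<rat> \<Longrightarrow> 0 \<le> q \<Longrightarrow> f q = h q" and "0 \<le> t"
  shows "f t = h t"
proof -
  \<comment> \<open>Approximation from the right keeps the rationals nonnegative, also for
    \<open>t = 0\<close>.\<close>
  have "\<exists>q\<in>\<rat>. t < q \<and> q < t + 1 / real (Suc n)" for n
    by (intro Rats_dense_in_real) simp
  then obtain q where q: "\<And>n. q n \<in> \<rat>" "\<And>n. t < q n" "\<And>n. q n < t + 1 / real (Suc n)"
    by metis
  have "(\<lambda>n. t + 1 / real (Suc n)) \<longlonglongrightarrow> t + 0"
    using LIMSEQ_inverse_real_of_nat by (intro tendsto_add tendsto_const) (simp add: inverse_eq_divide)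
  then have "q \<longlonglongrightarrow> t"
    using q(2,3) by (intro tendsto_sandwich[OF _ _ tendsto_const, of t q]) (auto simp: less_imp_le)
  moreover have "eventually (\<lambda>n. q n \<in> {0..}) sequentially"
    using order.trans[OF \<open>0 \<le> t\<close> less_imp_le[OF q(2)]] by simp
  ultimately have "(\<lambda>n. f (q n)) \<longlonglongrightarrow> f t" "(\<lambda>n. h (q n)) \<longlonglongrightarrow> h t"
    using \<open>0 \<le> t\<close>
    by (auto intro: continuous_on_tendsto_compose[OF assms(1)] continuous_on_tendsto_compose[OF assms(2)])
  moreover have "f (q n) = h (q n)" for n
    using eq[OF q(1)] q(2)[of n] \<open>0 \<le> t\<close> by auto
  ultimately show ?thesis using LIMSEQ_unique by simp
qed

lemma difference_quotient_shift:
  fixes P :: "real \<Rightarrow> real"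
  assumes "(P has_real_derivative D) (at t within {0..})"
  shows "((\<lambda>h. (P (t + h) - P t) / h) \<longlongrightarrow> D) (at 0 within {h. t + h \<ge> 0})"
proof -
  have "((\<lambda>y. (P y - P t) / (y - t)) \<longlongrightarrow> D) (at t within {0..})"
    using assms by (simp add: has_field_derivative_iff)
  moreover have "filterlim (\<lambda>h. t + h) (at t within {0..}) (at 0 within {h. t + h \<ge> 0})"
    unfolding filterlim_at
  proof
    show "\<forall>\<^sub>F h in at 0 within {h. 0 \<le> t + h}. t + h \<in> {0..} \<and> t + h \<noteq> t"
      by (simp add: eventually_at_filter)
    have "((\<lambda>h. t + h) \<longlongrightarrow> t + 0) (at 0 within {h. 0 \<le> t + h})"
      by (intro tendsto_intros)
    then show "((\<lambda>h. t + h) \<longlongrightarrow> t) (at 0 within {h. 0 \<le> t + h})" by simp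
  qed
  ultimately have "((\<lambda>h. (P (t + h) - P t) / (t + h - t)) \<longlongrightarrow> D) (at 0 within {h. t + h \<ge> 0})"
    by (rule filterlim_compose)
  then show ?thesis by simp
qed

text \<open>By the equation, \<open>X - I\<close> is the initial value plus the drift, a primitive
  of a continuous path, so its square sums vanish in the limit.\<close>

lemma (in wiener_space) strong_solution_quadratic_variation:
  assumes sol: "strong_solution M W \<mu> \<gamma> x0 X" and qv: "quadratic_variation M X Q"
    and \<mu>: "continuous_on UNIV \<mu>" and t: "0 \<le> t"
  shows "AE \<omega> in M. Q t \<omega> = (LBINT s:{0..t}. (\<gamma> (X s \<omega>))\<^sup>2)"
proof -
  obtain I where I: "has_ito_integral M F W (\<lambda>s \<omega>. \<gamma> (X s \<omega>)) I"
    and X: "AE \<omega> in M. \<forall>t\<ge>0. X t \<omega> = x0 + (LBINT s:{0..t}. \<mu> (X s \<omega>)) + I t \<omega>"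
    using sol unfolding strong_solution_def by blast
  have cont: "AE \<omega> in M. continuous_on {0..} (\<lambda>t. X t \<omega>)"
    using sol by (simp add: strong_solution_def continuous_process_def)
  have "AE \<omega> in M. (\<lambda>n. \<Sum>k = 1..(2::nat) ^ n.
      (X (real k * t / 2 ^ n) \<omega> - X ((real k - 1) * t / 2 ^ n) \<omega>)\<^sup>2) \<longlonglongrightarrow> Q t \<omega>"
    using qv t unfolding quadratic_variation_def by blast
  then have "AE \<omega> in M. (\<lambda>m. dyadic_sq_sum (\<lambda>x. X x \<omega>) t m) \<longlonglongrightarrow> Q t \<omega>"
  proof eventually_elim
    case (elim \<omega>)
    then show ?case by (simp only: dyadic_sq_sum_from_1[of "\<lambda>x. X x \<omega>"])
  qed
  moreover have "AE \<omega> in M. (\<lambda>m. dyadic_sq_sum (\<lambda>x. X x \<omega> - I x \<omega>) t m) \<longlonglongrightarrow> 0"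
    using X cont
  proof eventually_elim
    case (elim \<omega>)
    then have "continuous_on {0..} (\<lambda>s. \<mu> (X s \<omega>))"
      by (intro continuous_on_compose2[OF \<mu>]) auto
    then show ?case using t elim by (intro primitive_dyadic_sq_sum[where c=x0]) simp_all
  qed
  ultimately show ?thesis by (rule ito_dyadic_sq_sum_limit[OF I t])
qed

theorem proposition5p3:
  fixes M :: "'a measure"
    and W r Q :: "real \<Rightarrow> 'a \<Rightarrow> real"
    and a b \<sigma> \<beta> r0 T :: real
  assumes "prob_space M"
    and "wiener_process M W"
    and "a > 0" and "b > 0" and "\<sigma> > 0"
    and "1/2 < \<beta>" and "\<beta> < 1" and "r0 > 0"
    and "strong_solution M W (\<lambda>x. a - b * x) (\<lambda>x. \<sigma> * x powr \<beta>) r0 r"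
    and "AE \<omega> in M. \<forall>t\<ge>0. r t \<omega> > 0"
    and "quadratic_variation M r Q"
    and "T > 0"
  shows "\<forall>t\<in>{0..T}. AE \<omega> in M.
           (t > 0 \<longrightarrow> \<sigma>\<^sup>2 = Q t \<omega> / (LBINT s:{0..t}. r s \<omega> powr (2 * \<beta>))) \<and>
           ((\<lambda>h. (Q (t + h) \<omega> - Q t \<omega>) / (h * r t \<omega> powr (2 * \<beta>))) \<longlongrightarrow> \<sigma>\<^sup>2)
             (at 0 within {h. t + h \<ge> 0})"
proof
  fix t assume "t \<in> {0..T}"
  then have "0 \<le> t" by simp
  interpret wiener_space M W
    using assms(1,2) by (intro wiener_space.intro wiener_space_axioms.intro)
  have "AE \<omega> in M. Q q \<omega> = (LBINT s:{0..q}. (\<sigma> * r s \<omega> powr \<beta>)\<^sup>2)" if "0 \<le> q" for q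
    using that by (intro strong_solution_quadratic_variation[OF assms(9,11)]) (intro continuous_intros)
  \<comment> \<open>The limit in \<open>h\<close> involves uncountably many times
    \<open>t + h\<close>, hence the detour through a countable set.\<close>
  then have "AE \<omega> in M. \<forall>q\<in>\<rat> \<inter> {0..}. Q q \<omega> = (LBINT s:{0..q}. (\<sigma> * r s \<omega> powr \<beta>)\<^sup>2)"
    using countable_rat by (intro AE_ball_countable') auto
  moreover have "AE \<omega> in M. continuous_on {0..} (\<lambda>t. r t \<omega>)" "AE \<omega> in M. continuous_on {0..} (\<lambda>t. Q t \<omega>)"
    using assms(9,11) by (simp_all add: strong_solution_def quadratic_variation_def continuous_process_def)
  ultimately show "AE \<omega> in M.
           (t > 0 \<longrightarrow> \<sigma>\<^sup>2 = Q t \<omega> / (LBINT s:{0..t}. r s \<omega> powr (2 * \<beta>))) \<and>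
           ((\<lambda>h. (Q (t + h) \<omega> - Q t \<omega>) / (h * r t \<omega> powr (2 * \<beta>))) \<longlongrightarrow> \<sigma>\<^sup>2)
             (at 0 within {h. t + h \<ge> 0})"
    using assms(10)
  proof eventually_elim
    case (elim \<omega>)
    have pos: "0 < r s \<omega>" if "0 \<le> s" for s
      using elim that by simp
    have nz: "r s \<omega> \<noteq> 0" if "0 \<le> s" for s
      using pos[OF that] by simp
    define g where "g = (\<lambda>s. r s \<omega> powr (2 * \<beta>))"
    define P where "P = (\<lambda>x. LBINT s:{0..x}. g s)"
    have g: "continuous_on {0..} g"
      unfolding g_def using elim nz by (intro continuous_intros) auto
    have g_pos: "0 < g s" if "0 \<le> s" for s
      using nz[OF that] by (simp add: g_def)
    have P': "(P has_real_derivative g x) (at x within {0..})" if "0 \<le> x" for x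
      unfolding P_def using g that by (rule primitive_has_derivative)
    have P_cont: "continuous_on {0..} (\<lambda>x. \<sigma>\<^sup>2 * P x)"
      by (intro continuous_intros) (auto simp: continuous_on_eq_continuous_within intro: DERIV_continuous P')
    have "(LBINT s:{0..x}. (\<sigma> * r s \<omega> powr \<beta>)\<^sup>2) = (LBINT s:{0..x}. \<sigma>\<^sup>2 * g s)" for x
      using pos nz by (intro set_lebesgue_integral_cong)
        (auto simp: g_def power_mult_distrib powr_power mult.commute)
    then have "Q x \<omega> = \<sigma>\<^sup>2 * P x" if "0 \<le> x" for x
      using continuous_eq_if_eq_on_rats[OF _ P_cont _ that, of "\<lambda>x. Q x \<omega>"] elim
      by (simp add: P_def)
    note Q = this
    have "((\<lambda>h. (P (t + h) - P t) / h * (\<sigma>\<^sup>2 / g t)) \<longlongrightarrow> g t * (\<sigma>\<^sup>2 / g t)) (at 0 within {h. t + h \<ge> 0})"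
      by (intro tendsto_mult tendsto_const difference_quotient_shift P' \<open>0 \<le> t\<close>)
    moreover have "g t * (\<sigma>\<^sup>2 / g t) = \<sigma>\<^sup>2" using g_pos[OF \<open>0 \<le> t\<close>] by simp
    \<comment> \<open>The constant factor \<open>\<sigma>\<^sup>2 / g t\<close> turns the difference
      quotient of \<open>P\<close> into that of \<open>Q\<close>; times \<open>t + h < 0\<close>, at
      which \<open>Q\<close> is not identified, are excluded by the filter.\<close>
    moreover have "\<forall>\<^sub>F h in at 0 within {h. t + h \<ge> 0}.
        (P (t + h) - P t) / h * (\<sigma>\<^sup>2 / g t) = (Q (t + h) \<omega> - Q t \<omega>) / (h * g t)"
      using Q \<open>0 \<le> t\<close> by (simp add: eventually_at_filter algebra_simps diff_divide_distrib)
    ultimately have "((\<lambda>h. (Q (t + h) \<omega> - Q t \<omega>) / (h * g t)) \<longlongrightarrow> \<sigma>\<^sup>2) (at 0 within {h. t + h \<ge> 0})"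
      using Lim_transform_eventually by fastforce
    \<comment> \<open>At \<open>t = 0\<close> numerator and denominator both vanish; for
      \<open>t > 0\<close> positivity of the path makes the integral positive.\<close>
    moreover have "\<sigma>\<^sup>2 = Q t \<omega> / P t" if "t > 0"
    proof -
      have "0 < P t"
        unfolding P_def using that g_pos continuous_on_subset[OF g, of "{0..t}"]
        by (intro primitive_pos) auto
      then show ?thesis using Q[OF \<open>0 \<le> t\<close>] by simp
    qed
    ultimately show ?case by (simp add: P_def g_def)
  qed
qed

end
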